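(* Let $k\ge1$ be an integer. (1) Let $n$ be an even positive integer and let $a_1,\ldots,a_n$ be real numbers such that $\sum_{i=1}^n a_i^2=1$ and $\sum_{i=1}^n a_i=0$. Then $$h_{2k}(a_1,\ldots,a_n)\ \ge\ \frac{\left(\frac n2+k-1\right)!}{k!\,\left(\frac n2-1\right)!\,n^k},$$ and equality is attained at the vector $$\tilde a=\Big(\underbrace{\tfrac1{\sqrt n},\ldots,\tfrac1{\sqrt n}}_{n/2},\underbrace{-\tfrac1{\sqrt n},\ldots,-\tfrac1{\sqrt n}}_{n/2}\Big).$$ (2) For every integer $n\ge2$, odd or even, the maximum of $h_{2k}(a_1,\ldots,a_n)$ over all real $a_1,\ldots,a_n$ with $\sum_{i=1}^n a_i^2=1$ and $\sum_{i=1}^n a_i=0$ is attained at the vector $$\Big(\underbrace{-\tfrac1{\sqrt{n(n-1)}},\ldots,-\tfrac1{\sqrt{n(n-1)}}}_{n-1},\ \sqrt{\tfrac{n-1}{n}}\Big).$$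
   Context: For an integer $k\ge 0$, $h_k$ denotes the complete homogeneous symmetric polynomial of degree $k$: $h_k(a_1,\ldots,a_n)=\sum_{1\le i_1\le\cdots\le i_k\le n}a_{i_1}\cdots a_{i_k}$, with $h_0=1$. *)

theory Defs
  imports "HOL-Analysis.Analysis"
begin

text \<open>
  A vector \<open>(a_1, ..., a_n)\<close> is a function \<open>a :: nat \<Rightarrow> real\<close> of which only the values
  on \<open>{1..n}\<close> matter.
\<close>

text \<open>
  The index tuples \<open>1 \<le> i_1 \<le> ... \<le> i_k \<le> n\<close> are the sorted lists of length \<open>k\<close> over
  \<open>{1..n}\<close>.
\<close>

definition index_tuples :: "nat \<Rightarrow> nat \<Rightarrow> nat list set" where
  "index_tuples n k = {is. length is = k \<and> sorted is \<and> set is \<subseteq> {1..n}}"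

definition complete_hom :: "nat \<Rightarrow> nat \<Rightarrow> (nat \<Rightarrow> real) \<Rightarrow> real" where
  "complete_hom k n a = (\<Sum>is\<in>index_tuples n k. \<Prod>i\<leftarrow>is. a i)"

text \<open>The sum in \<open>complete_hom\<close> is a genuine one, as its index set is finite.\<close>

lemma finite_index_tuples: "finite (index_tuples n k)"
  by (rule finite_subset[OF _ finite_lists_length_eq[of "{1..n}" k]])
     (auto simp: index_tuples_def)

lemma complete_hom_0: "complete_hom 0 n a = 1"
proof -
  have "index_tuples n 0 = {[]}"
    by (auto simp: index_tuples_def)
  then show ?thesis
    by (simp add: complete_hom_def)
qed

definition centred_unit_vector :: "nat \<Rightarrow> (nat \<Rightarrow> real) \<Rightarrow> bool" where
  "centred_unit_vector n a \<longleftrightarrow> (\<Sum>i=1..n. (a i)\<^sup>2) = 1 \<and> (\<Sum>i=1..n. a i) = 0"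

definition min_vector :: "nat \<Rightarrow> nat \<Rightarrow> real" where
  "min_vector n = (\<lambda>i. if i \<le> n div 2 then 1 / sqrt (real n) else - 1 / sqrt (real n))"

definition max_vector :: "nat \<Rightarrow> nat \<Rightarrow> real" where
  "max_vector n = (\<lambda>i. if i \<le> n - 1 then - 1 / sqrt (real n * (real n - 1))
                        else sqrt ((real n - 1) / real n))"

end

theory Submission
  imports Defs "HOL-Computational_Algebra.Formal_Power_Series"
begin

text \<open>
  Everything is expressed through \<open>h_m(M)\<close> for a finite multiset \<open>M\<close> of reals, the coefficient of
  \<open>t^m\<close> in \<open>\<Prod>x\<in>M. 1 / (1 - x t)\<close>.  Adjoining a further entry \<open>x\<close> to \<open>M\<close> is at once
  differentiation (\<open>\<partial>h_m / \<partial>a_i\<close> is \<open>h_{m-1}\<close> of the vector with \<open>a_i\<close> repeated) and the taking of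
  divided differences (\<open>chom_diff\<close>), so every quantity that decides convexity is again a complete
  homogeneous polynomial.  In even degree these are nonnegative, and positive as soon as some entry is
  nonzero (\<open>chom_even_nonneg\<close>, \<open>chom_even_pos\<close>).

  \<^emph>\<open>Minimum.\<close>  If the entries of \<open>M\<close> sum to 0, Euler's identity becomes
  \<open>2k h_{2k}(M) = \<Sum>x\<in>M. x\<^sup>2 w(x)\<close> with \<open>w(x) = h_{2k-2}(M, x)\<close>, while
  \<open>\<Sum>x\<in>M. w(x) = (n + 2k - 2) h_{2k-2}(M)\<close>.  If all \<open>x\<^sup>2\<close> equal \<open>1/n\<close>, this gives
  \<open>h_{2k} = (n + 2k - 2) / (2kn) h_{2k-2}\<close>, hence the value at the alleged minimiser.  It
  remains to see that the right-hand side is a lower bound at a minimiser, whatever the parity of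
  \<open>n\<close>; induction on \<open>k\<close> then does the rest (\<open>chom_lower_bound\<close>).  The Lagrange conditions say
  that \<open>x w(x) = l + \<mu> x\<close> on \<open>M\<close> with \<open>\<mu> = 2k h_{2k}(M)\<close>, so the claim is
  \<open>\<Sum>x\<in>M. w(x) \<le> n \<mu>\<close>, which follows from the convexity of \<open>w\<close> (\<open>critical_sum_le_nonneg\<close>).

  \<^emph>\<open>Maximum.\<close>  Move three entries with their sum and sum of squares fixed.  Of their
  elementary symmetric functions only the product then changes, and \<open>h_{2k}\<close> is a convex
  function of it (\<open>chom_exchange\<close>).  So no three entries of a maximiser are distinct, as their
  product could be moved in both directions.  If there were two entries \<open>x\<close> and two smaller
  entries \<open>y\<close>, the triples \<open>x, y, y\<close> and \<open>x, x, y\<close> would have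
  extreme products, and maximality would force opposite signs on two values of \<open>h_{2k-3}\<close> that are
  ordered the other way.  Hence one entry stands against \<open>n - 1\<close> equal ones, and the constraints
  determine such a vector up to sign.  For the small \<open>k\<close>, where this convexity is not strict, the
  argument is applied to \<open>h_{2k} + \<epsilon> h_6\<close> and \<open>\<epsilon>\<close> tends to 0.
\<close>

section \<open>Complete homogeneous polynomials of a multiset of reals\<close>

definition lin_fps :: "real \<Rightarrow> real fps" where
  "lin_fps x = 1 - fps_const x * fps_X"

definition chom_gf :: "real multiset \<Rightarrow> real fps" where
  "chom_gf M = (\<Prod>x\<in>#M. inverse (lin_fps x))"

text \<open>
  Degrees are integers, and the value in negative degree is 0.  All the identities that lower the
  degree then hold without a case distinction.
\<close>

definition chom :: "int \<Rightarrow> real multiset \<Rightarrow> real" where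
  "chom m M = (if m < 0 then 0 else fps_nth (chom_gf M) (nat m))"

lemma chom_neg: "m < 0 \<Longrightarrow> chom m M = 0"
  by (simp add: chom_def)

lemma lin_fps_inverse: "lin_fps x * inverse (lin_fps x) = 1"
  by (rule inverse_mult_eq_1') (simp add: lin_fps_def)

lemma chom_gf_add_mset: "lin_fps x * chom_gf (add_mset x M) = chom_gf M"
  by (simp add: chom_gf_def mult.assoc[symmetric] lin_fps_inverse)

text \<open>
  The coefficients of \<open>G(M) = (1 - x t) G(M, x)\<close>, where \<open>G\<close> is the generating function.
\<close>

lemma chom_add_mset: "chom m (add_mset x M) = chom m M + x * chom (m - 1) (add_mset x M)"
proof (cases "m < 0")
  case False
  have "fps_nth (chom_gf M) (nat m) = fps_nth (chom_gf (add_mset x M)) (nat m)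
      - x * fps_nth (fps_X * chom_gf (add_mset x M)) (nat m)"
    unfolding chom_gf_add_mset[of x M, symmetric] lin_fps_def
    by (simp add: algebra_simps)
  with False show ?thesis
    by (cases "m = 0") (auto simp: chom_def nat_diff_distrib)
qed (simp add: chom_def)

lemma chom_empty: "chom m {#} = (if m = 0 then 1 else 0)"
  by (simp add: chom_def chom_gf_def)

lemma chom_0: "chom 0 M = 1"
  by (induction M) (simp_all add: chom_empty chom_add_mset[of 0] chom_neg)

lemma chom_singleton: "chom (int k) {#x#} = x ^ k"
  by (induction k) (simp_all add: chom_0 chom_add_mset[of "1 + int _"] chom_empty)

text \<open>
  The recursion adjoins \<open>y\<close> to \<open>M, x\<close> and \<open>x\<close> to \<open>M, y\<close>; both lead to \<open>M, x, y\<close>.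
\<close>

lemma chom_diff:
  "chom m (add_mset x M) - chom m (add_mset y M)
     = (x - y) * chom (m - 1) (add_mset x (add_mset y M))"
  using chom_add_mset[of m x "add_mset y M"] chom_add_mset[of m y "add_mset x M"]
  by (simp add: algebra_simps add_mset_commute)

text \<open>
  With the first two elementary symmetric functions equal, the denominators
  \<open>(1 - x t) (1 - y t) (1 - z t)\<close> of the two triples differ by a multiple of \<open>t^3\<close> only.  This is a
  finite-difference form of the derivative with respect to the product \<open>x y z\<close>, and applying it twice
  gives the second derivative.
\<close>

lemma chom_exchange:
  assumes "x' + y' + z' = x + y + z" "x' * y' + y' * z' + z' * x' = x * y + y * z + z * x"
  shows "chom m (N + {#x', y', z'#}) - chom m (N + {#x, y, z#})
     = (x' * y' * z' - x * y * z) * chom (m - 3) (N + {#x, y, z#} + {#x', y', z'#})"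
proof (cases "m < 0")
  case False
  define G where "G = chom_gf (N + {#x, y, z#} + {#x', y', z'#})"
  have q: "lin_fps a * lin_fps b * lin_fps c = 1 - fps_const (a + b + c) * fps_X
     + fps_const (a * b + b * c + c * a) * fps_X^2 - fps_const (a * b * c) * fps_X ^ 3" for a b c
  proof -
    have "(1 - A * X) * (1 - B * X) * (1 - C * X)
        = 1 - (A + B + C) * X + (A * B + B * C + C * A) * X^2 - A * B * C * X ^ 3"
      for A B C X :: "real fps"
      by algebra
    then show ?thesis
      by (simp add: lin_fps_def flip: fps_const_add fps_const_mult)
  qed
  have *: "lin_fps a * lin_fps b * lin_fps c * chom_gf (K + {#a, b, c#}) = chom_gf K" for a b c K
  proof -
    have "K + {#a, b, c#} = add_mset c (add_mset b (add_mset a K))" by simp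
    thus ?thesis by (simp only: mult.assoc chom_gf_add_mset)
  qed
  have G1: "chom_gf (N + {#x', y', z'#}) = lin_fps x * lin_fps y * lin_fps z * G"
    unfolding G_def by (subst *[of x y z, symmetric]) (simp only: add.assoc add.commute[of "{#x, y, z#}"])
  have G2: "chom_gf (N + {#x, y, z#}) = lin_fps x' * lin_fps y' * lin_fps z' * G"
    unfolding G_def by (simp only: *)
  have "lin_fps x * lin_fps y * lin_fps z - lin_fps x' * lin_fps y' * lin_fps z'
      = fps_const (x' * y' * z' - x * y * z) * fps_X ^ 3"
    unfolding q assms by (simp add: left_diff_distrib flip: fps_const_sub)
  hence "chom_gf (N + {#x', y', z'#}) - chom_gf (N + {#x, y, z#})
      = fps_const (x' * y' * z' - x * y * z) * (fps_X ^ 3 * G)"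
    unfolding G1 G2 by (simp only: left_diff_distrib[symmetric] mult.assoc[symmetric])
  hence "fps_nth (chom_gf (N + {#x', y', z'#}) - chom_gf (N + {#x, y, z#})) (nat m)
      = (x' * y' * z' - x * y * z) * fps_nth (fps_X ^ 3 * G) (nat m)"
    by (simp only: fps_mult_left_const_nth)
  moreover have "fps_nth (fps_X ^ 3 * G) (nat m) = chom (m - 3) (N + {#x, y, z#} + {#x', y', z'#})"
    using False by (auto simp: fps_X_power_mult_nth chom_def G_def nat_diff_distrib nat_less_iff)
  ultimately show ?thesis
    using False by (simp add: chom_def)
qed (simp add: chom_def)

text \<open>
  Euler's identity for homogeneous functions, as \<open>h_{m-1}(M, y)\<close> is the derivative of \<open>h_m(M)\<close> in
  the entry \<open>y\<close>.  The recursion of \<open>chom_add_mset\<close> reduces it to smaller multisets and smaller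
  degrees.
\<close>

lemma chom_euler:
  "(\<Sum>y\<in>#M. y * chom (m - 1) (add_mset y M)) = of_int m * chom m M"
proof (induction M arbitrary: m)
  case empty
  then show ?case by (simp add: chom_empty)
next
  case (add x M)
  show ?case
  proof (cases "m < 0")
    case False
    then obtain k where "m = int k" by (metis nonneg_int_cases not_less)
    moreover have "(\<Sum>y\<in>#add_mset x M. y * chom (int k - 1) (add_mset y (add_mset x M)))
       = real k * chom (int k) (add_mset x M)"
    proof (induction k)
      case (Suc k)
      have *: "chom (int k) (add_mset y (add_mset x M))
          = chom (int k) (add_mset y M) + x * chom (int k - 1) (add_mset y (add_mset x M))" for y
        using chom_add_mset[of "int k" x "add_mset y M"] by (simp add: add_mset_commute)
      have "(\<Sum>y\<in>#M. y * chom (int k) (add_mset y (add_mset x M)))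
         = (\<Sum>y\<in>#M. y * chom (int k) (add_mset y M))
             + x * (\<Sum>y\<in>#M. y * chom (int k - 1) (add_mset y (add_mset x M)))"
        by (subst *) (simp add: algebra_simps sum_mset.distrib sum_mset_distrib_left)
      also have "(\<Sum>y\<in>#M. y * chom (int k) (add_mset y M)) = real (Suc k) * chom (int (Suc k)) M"
        using add.IH[of "int (Suc k)"] by simp
      finally have "(\<Sum>y\<in>#add_mset x M. y * chom (int k) (add_mset y (add_mset x M)))
         = x * chom (int k) (add_mset x (add_mset x M)) + real (Suc k) * chom (int (Suc k)) M
           + x * (\<Sum>y\<in>#M. y * chom (int k - 1) (add_mset y (add_mset x M)))"
        by simp
      also have "x * chom (int k) (add_mset x (add_mset x M))
          = x * chom (int k) (add_mset x M) 
            + x * (x * chom (int k - 1) (add_mset x (add_mset x M)))"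
        using chom_add_mset[of "int k" x "add_mset x M"] by (simp add: algebra_simps)
      finally have "(\<Sum>y\<in>#add_mset x M. y * chom (int k) (add_mset y (add_mset x M)))
         = x * chom (int k) (add_mset x M) + real (Suc k) * chom (int (Suc k)) M
           + x * (\<Sum>y\<in>#add_mset x M. y * chom (int k - 1) (add_mset y (add_mset x M)))"
        by (simp add: algebra_simps)
      also have "\<dots> = real (Suc k) * (chom (int (Suc k)) M + x * chom (int k) (add_mset x M))"
        unfolding Suc.IH by (simp add: algebra_simps)
      also have "\<dots> = real (Suc k) * chom (int (Suc k)) (add_mset x M)"
        using chom_add_mset[of "int (Suc k)" x M] by simp
      finally show ?case by simp
    qed (simp add: chom_neg)
    ultimately show ?thesis by simp
  qed (simp add: chom_neg)
qed

text \<open>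
  The derivative of \<open>h_{m+1}(M)\<close> when all entries are translated by the same amount.
\<close>

lemma sum_chom_add_mset:
  "(\<Sum>y\<in>#M. chom m (add_mset y M)) = (real (size M) + of_int m) * chom m M"
proof -
  have "(\<Sum>y\<in>#M. chom m (add_mset y M))
      = (\<Sum>y\<in>#M. chom m M + y * chom (m - 1) (add_mset y M))"
    by (subst chom_add_mset) simp
  also have "\<dots> = real (size M) * chom m M + of_int m * chom m M"
    by (simp add: sum_mset.distrib chom_euler)
  finally show ?thesis by (simp add: algebra_simps)
qed

lemma chom_euler_squares:
  assumes "\<Sum>\<^sub># M = 0"
  shows "of_int m * chom m M = (\<Sum>y\<in>#M. y\<^sup>2 * chom (m - 2) (add_mset y M))"
proof -
  have "of_int m * chom m M = (\<Sum>y\<in>#M. y * chom (m - 1) M + y\<^sup>2 * chom (m - 2) (add_mset y M))"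
    unfolding chom_euler[where M = M and m = m, symmetric]
    by (subst chom_add_mset) (simp add: algebra_simps power2_eq_square)
  also have "\<dots> = (\<Sum>y\<in>#M. y) * chom (m - 1) M
      + (\<Sum>y\<in>#M. y\<^sup>2 * chom (m - 2) (add_mset y M))"
    by (simp add: sum_mset.distrib flip: sum_mset_distrib_right)
  finally show ?thesis using assms by simp
qed

lemma chom_scale: "chom (int k) (image_mset ((*) r) M) = r ^ k * chom (int k) M"
proof (induction M arbitrary: k)
  case (add x M)
  show ?case
  proof (induction k)
    case (Suc k)
    have "chom (int (Suc k)) (image_mset ((*) r) (add_mset x M))
        = chom (int (Suc k)) (image_mset ((*) r) M)
            + r * x * chom (int k) (image_mset ((*) r) (add_mset x M))"
      using chom_add_mset[of "int (Suc k)" "r * x"] by simp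
    also have "\<dots> = r ^ Suc k * (chom (int (Suc k)) M + x * chom (int k) (add_mset x M))"
      unfolding Suc.IH add.IH by (simp add: algebra_simps)
    also have "chom (int (Suc k)) M + x * chom (int k) (add_mset x M)
        = chom (int (Suc k)) (add_mset x M)"
      using chom_add_mset[of "int (Suc k)" x M] by simp
    finally show ?case .
  qed (simp add: chom_0)
qed (simp add: chom_empty)

lemma chom_uminus_even:
  assumes "even m"
  shows "chom m (image_mset uminus M) = chom m M"
proof (cases "m < 0")
  case False
  then obtain k where k: "m = int k" by (metis nonneg_int_cases not_less)
  have "image_mset uminus M = image_mset ((*) (- 1)) M" by (intro image_mset_cong) simp
  with assms show ?thesis by (simp add: k chom_scale del: mult_minus1)
qed (simp add: chom_neg)

lemma chom_add_mset_expand: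
  "chom (int k) (add_mset x M) = (\<Sum>i\<le>k. x ^ i * chom (int (k - i)) M)"
proof (induction k)
  case (Suc k)
  have "chom (int (Suc k)) (add_mset x M) = chom (int (Suc k)) M + x * chom (int k) (add_mset x M)"
    using chom_add_mset[of "int (Suc k)" x M] by simp
  then show ?case unfolding Suc.IH
    by (subst sum.atMost_Suc_shift) (simp add: sum_distrib_left mult.assoc)
qed (simp add: chom_0)

text \<open>
  Newton's identities: \<open>chom_add_mset_expand\<close> inserted into Euler's identity.
\<close>

lemma chom_newton:
  "real (Suc k) * chom (int (Suc k)) M = (\<Sum>i\<le>k. (\<Sum>x\<in>#M. x ^ Suc i) * chom (int (k - i)) M)"
proof -
  have sm: "(\<Sum>y\<in>#N. \<Sum>i\<le>k. f y i) = (\<Sum>i\<le>k. \<Sum>y\<in>#N. f y i)" 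
    for N and f :: "real \<Rightarrow> nat \<Rightarrow> real"
    by (induction N) (simp_all add: sum.distrib)
  have "real (Suc k) * chom (int (Suc k)) M = (\<Sum>y\<in>#M. y * chom (int k) (add_mset y M))"
    using chom_euler[where M = M and m = "int (Suc k)"] by simp
  also have "\<dots> = (\<Sum>y\<in>#M. \<Sum>i\<le>k. y ^ Suc i * chom (int (k - i)) M)"
    by (simp add: chom_add_mset_expand sum_distrib_left mult.assoc)
  also have "\<dots> = (\<Sum>i\<le>k. (\<Sum>x\<in>#M. x ^ Suc i) * chom (int (k - i)) M)"
    unfolding sm by (simp add: sum_mset_distrib_right)
  finally show ?thesis .
qed

section \<open>Positivity in even degree\<close>

text \<open>
  The coefficient of \<open>t^m\<close> in \<open>exp(y t) \<Prod>x\<in>M. 1 / (1 - x t)\<close>, an Appell polynomial in \<open>y\<close>.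
\<close>

definition appell :: "nat \<Rightarrow> real multiset \<Rightarrow> real \<Rightarrow> real" where
  "appell m M y = (\<Sum>j\<le>m. chom (int j) M * (y ^ (m - j) / fact (m - j)))"

lemma appell_at_0: "appell m M 0 = chom (int m) M"
proof -
  have "appell m M 0 = (\<Sum>j\<in>{m}. chom (int j) M * (0 ^ (m - j) / fact (m - j)))"
    unfolding appell_def by (rule sum.mono_neutral_right) (auto simp: power_0_left)
  then show ?thesis by simp
qed

lemma appell_empty: "appell m {#} y = y ^ m / fact m"
proof -
  have "appell m {#} y = (\<Sum>j\<in>{0}. chom (int j) {#} * (y ^ (m - j) / fact (m - j)))"
    unfolding appell_def by (rule sum.mono_neutral_right) (auto simp: chom_empty)
  then show ?thesis by (simp add: chom_0)
qed

text \<open>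
  In terms of \<open>D = d/dy\<close>, which maps \<open>appell (Suc m)\<close> to \<open>appell m\<close>, this reads
  \<open>(1 - x D) g(M, x) = g(M)\<close>.
\<close>

lemma appell_add_mset:
  "appell (Suc m) (add_mset x M) y = appell (Suc m) M y + x * appell m (add_mset x M) y"
proof -
  have "chom (int (Suc j)) (add_mset x M) = chom (int (Suc j)) M + x * chom (int j) (add_mset x M)" for j
    using chom_add_mset[of "int (Suc j)" x M] by simp
  then show ?thesis
    unfolding appell_def sum.atMost_Suc_shift
    by (simp add: algebra_simps sum.distrib sum_distrib_left chom_0)
qed

lemma DERIV_appell: "(appell (Suc m) M has_real_derivative appell m M y) (at y)"
proof -
  have "((\<lambda>y. y ^ Suc i / fact (Suc i)) has_real_derivative y ^ i / fact i) (at y)" for i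
    by (rule derivative_eq_intros refl | simp del: of_nat_Suc)+
  hence D: "((\<lambda>y. chom (int j) M * (y ^ (Suc m - j) / fact (Suc m - j))) has_real_derivative
      chom (int j) M * (y ^ (m - j) / fact (m - j))) (at y)" if "j \<le> m" for j
    using that by (intro DERIV_cmult) (simp only: Suc_diff_le)
  have "((\<lambda>y. \<Sum>j\<le>m. chom (int j) M * (y ^ (Suc m - j) / fact (Suc m - j))) has_real_derivative
      appell m M y) (at y)"
    unfolding appell_def by (rule DERIV_sum) (use D in auto)
  from DERIV_add[OF this DERIV_const[of "chom (int (Suc m)) M"]] show ?thesis
    by (simp add: appell_def[abs_def])
qed

text \<open>
  The leading term is \<open>y^m / m!\<close>.
\<close>

lemma eventually_appell_pos:
  assumes "even m"
  shows "eventually (\<lambda>y. appell m M y > 0) at_infinity"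
proof -
  have lim: "((\<lambda>y. \<Sum>j\<le>m. chom (int j) M * (inverse y ^ j / fact (m - j))) \<longlongrightarrow>
      (\<Sum>j\<le>m. chom (int j) M * (0 ^ j / fact (m - j)))) at_infinity"
    by (intro tendsto_intros tendsto_inverse_0) simp_all
  have "(\<Sum>j\<le>m. chom (int j) M * (0 ^ j / fact (m - j))) = 1 / fact m"
  proof -
    have "(\<Sum>j\<le>m. chom (int j) M * (0 ^ j / fact (m - j))) 
        = (\<Sum>j\<in>{0}. chom (int j) M * (0 ^ j / fact (m - j)))"
      by (rule sum.mono_neutral_right) (auto simp: power_0_left)
    then show ?thesis by (simp add: chom_0)
  qed
  with lim have "eventually (\<lambda>y. (\<Sum>j\<le>m. chom (int j) M * (inverse y ^ j / fact (m - j))) > 0) at_infinity"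
    using order_tendstoD(1)[OF lim, of 0] by simp
  moreover have "eventually (\<lambda>y::real. y \<noteq> 0) at_infinity"
    by (rule eventually_not_equal_at_infinity)
  ultimately show ?thesis
  proof eventually_elim
    case (elim y)
    have "y ^ m * (inverse y ^ j / fact (m - j)) = y ^ (m - j) / fact (m - j)" if "j \<le> m" for j
      using elim(2) that by (simp add: power_diff field_simps)
    hence "appell m M y = y ^ m * (\<Sum>j\<le>m. chom (int j) M * (inverse y ^ j / fact (m - j)))"
      unfolding appell_def sum_distrib_left
      by (intro sum.cong refl) (auto simp: mult.left_commute)
    with elim assms show ?case by (simp add: zero_less_power_eq)
  qed
qed

text \<open>
  By \<open>appell_add_mset\<close>, \<open>g(M, x) - x g'(M, x) = g(M)\<close>.  At a minimum of \<open>g(M, x)\<close>, which exists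
  in even degree, the derivative vanishes, so the minimal value is a value of \<open>g(M)\<close>, and
  nonnegativity passes from \<open>M\<close> to \<open>M, x\<close>.
\<close>

lemma appell_nonneg:
  assumes "even m"
  shows "appell m M y \<ge> 0"
proof (induction M arbitrary: y)
  case empty
  then show ?case using assms by (simp add: appell_empty zero_le_even_power)
next
  case (add x M)
  show ?case
  proof (cases m)
    case 0
    then show ?thesis by (simp add: appell_def chom_0)
  next
    case (Suc l)
    let ?g = "appell m (add_mset x M)"
    show ?thesis
    proof (rule ccontr)
      assume "\<not> ?g y \<ge> 0"
      hence neg: "?g y < 0" by simp
      obtain R where R: "\<And>z. norm z \<ge> R \<Longrightarrow> ?g z > 0"
        using eventually_appell_pos[OF assms, of "add_mset x M"] unfolding eventually_at_infinity
        by blast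
      have cont: "continuous_on A ?g" for A
        unfolding Suc by (meson DERIV_appell DERIV_isCont continuous_at_imp_continuous_on)
      have yR: "y \<in> cball 0 R" using R[of y] neg by (force simp: not_le)
      obtain z where z: "z \<in> cball 0 R" "\<And>u. u \<in> cball 0 R \<Longrightarrow> ?g z \<le> ?g u"
        using continuous_attains_inf[OF compact_cball _ cont, of 0 R] yR by blast
      have min: "?g z \<le> ?g u" for u
      proof (cases "u \<in> cball 0 R")
        case False
        hence "?g u > 0" using R[of u] by simp
        then show ?thesis using z(2)[OF yR] neg by linarith
      qed (use z in auto)
      have "appell l (add_mset x M) z = 0"
        using DERIV_local_min[of ?g _ z 1] DERIV_appell[of l "add_mset x M" z] min Suc by auto
      hence "?g z = appell m M z"
        unfolding Suc appell_add_mset by simp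
      with add.IH[of z] min[of y] neg show False by linarith
    qed
  qed
qed

lemma chom_even_nonneg:
  assumes "even m"
  shows "chom m M \<ge> 0"
proof (cases "m < 0")
  case False
  then obtain k where k: "m = int k" by (metis nonneg_int_cases not_less)
  with assms have "even k" by simp
  then show ?thesis using appell_nonneg[of k M 0] by (simp add: appell_at_0 k)
qed (simp add: chom_neg)

text \<open>
  For \<open>m > 0\<close> a zero of \<open>h_m(M, x)\<close> makes 0 a minimum of the corresponding nonnegative Appell polynomial.  So
  its derivative \<open>h_{m-1}(M, x)\<close> at 0 vanishes as well, and the recursion gives \<open>h_m(M) = 0\<close>.
\<close>

lemma chom_even_eq_0D:
  assumes "even m" "chom m (add_mset x M) = 0"
  shows "chom m M = 0"
proof (cases "m \<le> 0")
  case False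
  then obtain l where m: "m = int (Suc l)"
    by (metis not_le gr0_conv_Suc zero_less_imp_eq_int)
  with assms have ev: "even (Suc l)" by simp
  let ?g = "appell (Suc l) (add_mset x M)"
  have "?g 0 = 0" using assms(2) by (simp add: appell_at_0 m del: of_nat_Suc)
  hence "?g 0 \<le> ?g u" for u using appell_nonneg[OF ev, of "add_mset x M" u] by simp
  hence "appell l (add_mset x M) 0 = 0"
    using DERIV_local_min[of ?g _ 0 1] DERIV_appell[of l "add_mset x M" 0] by auto
  hence "chom (m - 1) (add_mset x M) = 0" by (simp add: appell_at_0 m)
  with assms(2) chom_add_mset[of m x M] show ?thesis by simp
next
  case True
  then have "m = 0 \<or> m < 0" by linarith
  then show ?thesis using assms(2) by (auto simp: chom_0 chom_neg)
qed

text \<open>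
  If \<open>h_m\<close> vanished at \<open>M\<close>, it would vanish at all its submultisets, but \<open>h_m({x}) = x^m \<noteq> 0\<close>.
\<close>

lemma chom_even_pos:
  assumes "even m" "m \<ge> 0" "x \<in># M" "x \<noteq> 0"
  shows "chom m M > 0"
proof -
  from assms obtain k where k: "m = int k" by (metis nonneg_int_cases)
  have "chom m (N + {#x#}) \<noteq> 0" for N
  proof (induction N)
    case empty
    then show ?case using assms by (simp add: k chom_singleton)
  next
    case (add y N)
    then show ?case
      using chom_even_eq_0D[OF assms(1), of y "N + {#x#}"] by (auto simp: add_mset_commute)
  qed
  moreover obtain N where "M = add_mset x N" using assms(3) by (metis multi_member_split)
  ultimately have "chom m M \<noteq> 0" by simp
  with chom_even_nonneg[OF assms(1), of M] show ?thesis by simp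
qed

section \<open>Vectors as multisets, and the existence of extremal vectors\<close>

definition coords :: "nat \<Rightarrow> (nat \<Rightarrow> real) \<Rightarrow> real multiset" where
  "coords n a = image_mset a (mset_set {1..n})"

lemma size_coords [simp]: "size (coords n a) = n"
  by (simp add: coords_def)

lemma coords_Suc: "coords (Suc n) a = add_mset (a (Suc n)) (coords n a)"
  by (simp add: coords_def atLeastAtMostSuc_conv)

lemma in_coords_iff: "x \<in># coords n a \<longleftrightarrow> (\<exists>i\<in>{1..n}. x = a i)"
  by (auto simp: coords_def)

lemma coords_cong: "(\<And>i. i \<in> {1..n} \<Longrightarrow> a i = b i) \<Longrightarrow> coords n a = coords n b"
  unfolding coords_def by (intro image_mset_cong) auto

lemma sum_coords: "(\<Sum>x\<in>#coords n a. f x) = (\<Sum>i=1..n. f (a i))" for f :: "real \<Rightarrow> real"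
  by (simp add: coords_def sum_unfold_sum_mset multiset.map_comp comp_def)

lemma obtain_coords:
  assumes "size M = n"
  obtains a where "coords n a = M"
proof -
  obtain xs where xs: "mset xs = M" by (metis ex_mset)
  with assms have len: "length xs = n" by auto
  have "coords n (\<lambda>i. xs ! (i - 1)) = image_mset (\<lambda>i. xs ! i) (image_mset (\<lambda>i. i - 1) (mset_set {1..n}))"
    by (simp add: coords_def multiset.map_comp comp_def)
  also have "image_mset (\<lambda>i. i - 1) (mset_set {1..n}) = mset_set ((\<lambda>i. i - 1) ` {1..n})"
    by (intro image_mset_mset_set) (auto simp: inj_on_def)
  also have "(\<lambda>i. i - 1) ` {1..n} = {..<n}"
    by (force simp: image_iff intro: bexI[of _ "Suc _"])
  also have "image_mset (\<lambda>i. xs ! i) (mset_set {..<n}) = mset (map (\<lambda>i. xs ! i) [0..<n])"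
    by (simp add: atLeast0LessThan flip: mset_set_upto_eq_mset_upto)
  also have "\<dots> = M" using xs len map_nth[of xs] by simp
  finally show ?thesis using that by blast
qed

lemma index_tuples_0_left: "index_tuples 0 (Suc k) = {}"
  by (auto simp: index_tuples_def length_Suc_conv)

text \<open>
  A tuple either avoids the largest index or ends with it.
\<close>

lemma index_tuples_Suc:
  "index_tuples (Suc n) (Suc k)
     = index_tuples n (Suc k) \<union> (\<lambda>is. is @ [Suc n]) ` index_tuples (Suc n) k"
proof (intro set_eqI iffI)
  fix js assume js: "js \<in> index_tuples (Suc n) (Suc k)"
  then obtain ks j where ij: "js = ks @ [j]"
    by (cases js rule: rev_cases) (auto simp: index_tuples_def)
  show "js \<in> index_tuples n (Suc k) \<union> (\<lambda>is. is @ [Suc n]) ` index_tuples (Suc n) k"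
  proof (cases "j = Suc n")
    case True
    then show ?thesis using js ij by (auto simp: index_tuples_def sorted_append)
  next
    case False
    with js ij have "j \<le> n" by (auto simp: index_tuples_def)
    moreover have "\<forall>i\<in>set js. i \<le> j" using js ij by (auto simp: index_tuples_def sorted_append)
    ultimately show ?thesis using js by (force simp: index_tuples_def)
  qed
qed (force simp: index_tuples_def sorted_append)+

lemma complete_hom_Suc:
  "complete_hom (Suc k) (Suc n) a
     = complete_hom (Suc k) n a + a (Suc n) * complete_hom k (Suc n) a"
proof -
  have "complete_hom (Suc k) (Suc n) a = complete_hom (Suc k) n a
      + (\<Sum>is\<in>(\<lambda>is. is @ [Suc n]) ` index_tuples (Suc n) k. \<Prod>i\<leftarrow>is. a i)"
    unfolding complete_hom_def index_tuples_Suc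
    by (intro sum.union_disjoint finite_imageI finite_index_tuples)
       (auto simp: index_tuples_def)
  also have "(\<Sum>is\<in>(\<lambda>is. is @ [Suc n]) ` index_tuples (Suc n) k. \<Prod>i\<leftarrow>is. a i)
      = (\<Sum>is\<in>index_tuples (Suc n) k. (\<Prod>i\<leftarrow>is. a i) * a (Suc n))"
    by (subst sum.reindex) (auto simp: inj_on_def)
  finally show ?thesis
    by (simp add: complete_hom_def sum_distrib_left mult.commute)
qed

text \<open>
  Both sides satisfy the same recursion in the number of variables and the degree.
\<close>

lemma complete_hom_eq_chom: "complete_hom k n a = chom (int k) (coords n a)"
proof (induction n arbitrary: k)
  case 0
  show ?case
  proof (cases k)
    case (Suc l)
    then show ?thesis
      by (simp add: complete_hom_def index_tuples_0_left coords_def chom_empty)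
  qed (simp add: complete_hom_0 chom_0)
next
  case (Suc n)
  show ?case
  proof (induction k)
    case (Suc k)
    have "complete_hom (Suc k) (Suc n) a
        = chom (int (Suc k)) (coords n a) + a (Suc n) * chom (int k) (coords (Suc n) a)"
      by (simp only: complete_hom_Suc Suc.IH \<open>\<And>k. complete_hom k n a = _\<close>)
    also have "int k = int (Suc k) - 1" by simp
    finally show ?case by (simp only: coords_Suc chom_add_mset[symmetric])
  qed (simp add: complete_hom_0 chom_0)
qed

lemma continuous_complete_hom: "continuous_on S (complete_hom k n)"
proof -
  have "continuous_on S (\<lambda>a. \<Prod>i\<leftarrow>is. a i :: real)" for "is" :: "nat list"
  proof (induction "is")
    case (Cons i js)
    have "continuous_on S (\<lambda>a::nat \<Rightarrow> real. a i)"
      by (rule continuous_on_subset[OF continuous_on_product_coordinates]) simp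
    from continuous_on_mult[OF this Cons] show ?case by simp
  qed simp
  thus ?thesis unfolding complete_hom_def[abs_def] by (intro continuous_on_sum)
qed

definition centred_unit_mset :: "real multiset \<Rightarrow> bool" where
  "centred_unit_mset M \<longleftrightarrow> (\<Sum>x\<in>#M. x\<^sup>2) = 1 \<and> \<Sum>\<^sub># M = 0"

lemma centred_unit_coords: "centred_unit_mset (coords n a) \<longleftrightarrow> centred_unit_vector n a"
  using sum_coords[of "\<lambda>x. x" n a]
  by (simp add: centred_unit_mset_def centred_unit_vector_def sum_coords)

lemma centred_unit_mset_nonzero:
  assumes "centred_unit_mset M"
  shows "\<exists>x\<in>#M. x \<noteq> 0"
proof (rule ccontr)
  assume "\<not> ?thesis"
  hence "(\<Sum>x\<in>#M. x\<^sup>2) = (\<Sum>x\<in>#M. 0)"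
    by (intro arg_cong[of _ _ sum_mset] image_mset_cong) auto
  with assms show False by (simp add: centred_unit_mset_def)
qed

text \<open>
  Compactness of the constraint set, realised inside a product of intervals with coordinates outside
  \<open>{1..n}\<close> set to 0.  Taking \<open>\<alpha> = -1\<close> and \<open>\<beta> = 0\<close> yields minimisers of \<open>h_p\<close>.
\<close>

lemma exists_chom_maximiser:
  fixes \<alpha> \<beta> :: real
  assumes "centred_unit_mset M0" "size M0 = n"
  obtains M where "centred_unit_mset M" "size M = n"
    "\<And>N. centred_unit_mset N \<Longrightarrow> size N = n \<Longrightarrow>
       \<alpha> * chom (int p) N + \<beta> * chom (int q) N \<le> \<alpha> * chom (int p) M + \<beta> * chom (int q) M"
proof -
  let ?F = "\<lambda>a. \<alpha> * complete_hom p n a + \<beta> * complete_hom q n a"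
  define B :: "(nat \<Rightarrow> real) set" where "B = (\<Pi>\<^sub>E i\<in>UNIV. if i \<in> {1..n} then {-1..1} else {0})"
  define S where "S = B \<inter> {a. centred_unit_vector n a}"
  have "compactin (product_topology (\<lambda>i::nat. euclidean :: real topology) UNIV) B"
    unfolding B_def compactin_PiE by auto
  hence "compact B" by (simp add: euclidean_product_topology)
  moreover have "closed {a. centred_unit_vector n a}"
    unfolding centred_unit_vector_def
    by (intro closed_Collect_conj closed_Collect_eq continuous_intros
          continuous_on_product_coordinates)
  ultimately have "compact S" unfolding S_def by (rule compact_Int_closed)
  have repr: "\<exists>a\<in>S. coords n a = N" if N: "centred_unit_mset N" "size N = n" for N
  proof -
    obtain b where b: "coords n b = N" using obtain_coords[OF N(2)] by blast
    define a where "a = (\<lambda>i. if i \<in> {1..n} then b i else 0)"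
    have a: "coords n a = N" unfolding b[symmetric] by (rule coords_cong) (simp add: a_def)
    hence cu: "centred_unit_vector n a" using N by (simp flip: centred_unit_coords)
    have "a i \<in> {-1..1}" if "i \<in> {1..n}" for i
    proof -
      have "(a i)\<^sup>2 \<le> (\<Sum>i=1..n. (a i)\<^sup>2)" using that by (intro member_le_sum) auto
      hence "(a i)\<^sup>2 \<le> 1" using cu by (simp add: centred_unit_vector_def)
      thus ?thesis by (simp add: abs_square_le_1 abs_le_iff)
    qed
    hence "a \<in> B" unfolding B_def by (auto simp: a_def)
    with a cu show ?thesis unfolding S_def by blast
  qed
  have "continuous_on S ?F" by (intro continuous_intros continuous_complete_hom)
  moreover have "S \<noteq> {}" using repr[OF assms] by blast
  ultimately obtain a where a: "a \<in> S" "\<And>b. b \<in> S \<Longrightarrow> ?F b \<le> ?F a"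
    using continuous_attains_sup[OF \<open>compact S\<close>] by blast
  show ?thesis
  proof
    show "centred_unit_mset (coords n a)" using a(1) by (simp add: S_def centred_unit_coords)
    show "\<alpha> * chom (int p) N + \<beta> * chom (int q) N
        \<le> \<alpha> * chom (int p) (coords n a) + \<beta> * chom (int q) (coords n a)"
      if "centred_unit_mset N" "size N = n" for N
      using repr[OF that] a(2) by (auto simp: complete_hom_eq_chom)
  qed simp
qed

section \<open>An inequality at critical points\<close>

text \<open>
  The second divided difference of \<open>u \<mapsto> h_m(M, u)\<close> at \<open>x, y, z\<close> is \<open>h_{m-2}(M, x, y, z)\<close>, a value in
  even degree.
\<close>

lemma chom_convex:
  assumes "even m" "x \<le> y" "y \<le> z"
  shows "(z - x) * chom m (add_mset y M)
    \<le> (z - y) * chom m (add_mset x M) + (y - x) * chom m (add_mset z M)"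
proof -
  let ?w = "\<lambda>u. chom m (add_mset u M)" and ?v = "\<lambda>u. chom (m - 1) (add_mset u (add_mset y M))"
  let ?d = "chom (m - 2) (add_mset z (add_mset x (add_mset y M)))"
  have "?w x - ?w y = (x - y) * ?v x" "?w z - ?w y = (z - y) * ?v z"
    by (rule chom_diff)+
  moreover have "?v z - ?v x = (z - x) * ?d"
    using chom_diff[of "m - 1" z "add_mset y M" x] by simp
  moreover have "(z - y) * ((x - y) * ?v x) + (y - x) * ((z - y) * ?v z)
      = (z - y) * (y - x) * (?v z - ?v x)"
    by (simp add: algebra_simps)
  ultimately have "(z - y) * (?w x - ?w y) + (y - x) * (?w z - ?w y)
      = (z - y) * (y - x) * ((z - x) * ?d)"
    by simp
  moreover have "\<dots> \<ge> 0"
    using assms chom_even_nonneg[of "m - 2"] by simp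
  ultimately show ?thesis by (simp add: algebra_simps)
qed

lemma chom_less_right_end:
  assumes "even m" "x < y" "y < z" "chom m (add_mset x M) < chom m (add_mset z M)"
  shows "chom m (add_mset y M) < chom m (add_mset z M)"
proof -
  let ?w = "\<lambda>u. chom m (add_mset u M)"
  have "(z - x) * ?w y \<le> (z - y) * ?w x + (y - x) * ?w z"
    using assms by (intro chom_convex) auto
  also have "\<dots> < (z - y) * ?w z + (y - x) * ?w z"
    using assms by simp
  also have "\<dots> = (z - x) * ?w z" by (simp add: algebra_simps)
  finally show ?thesis using assms by simp
qed

lemma sum_mset_uminus: "\<Sum>\<^sub># (image_mset uminus M) = - \<Sum>\<^sub># M" for M :: "real multiset"
  by (induction M) simp_all

lemma sum_mset_zero_signs:
  fixes M :: "real multiset"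
  assumes "\<Sum>\<^sub># M = 0" "x \<in># M" "x \<noteq> 0"
  obtains u v where "u \<in># M" "v \<in># M" "u < 0" "0 < v"
proof -
  have *: "\<exists>v\<in>#K. 0 < v" if "\<Sum>\<^sub># K = 0" "\<exists>x\<in>#K. x \<noteq> 0" for K :: "real multiset"
  proof (rule ccontr)
    assume "\<not> (\<exists>v\<in>#K. 0 < v)"
    hence le: "\<forall>v\<in>#K. v \<le> 0" by force
    from that(2) obtain x L where "x \<noteq> 0" and K: "K = add_mset x L" by (metis multi_member_split)
    have "(\<Sum>v\<in>#L. v) \<le> (\<Sum>v\<in>#L. 0)"
      using le K by (intro sum_mset_mono) auto
    with le K \<open>x \<noteq> 0\<close> that(1) show False by auto
  qed
  have "\<Sum>\<^sub># (image_mset uminus M) = 0"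
    using assms(1) by (simp add: sum_mset_uminus)
  with *[of "image_mset uminus M"] *[of M] assms that show ?thesis by fastforce
qed

text \<open>
  In Newton's identities for an odd degree every summand pairs an odd power sum with an even \<open>h\<close> or an
  even power sum with an odd \<open>h\<close> of smaller degree.
\<close>

lemma chom_odd_nonpos:
  assumes "\<And>i. odd i \<Longrightarrow> (\<Sum>x\<in>#M. x ^ i) \<le> 0" "odd k"
  shows "chom (int k) M \<le> 0"
  using assms(2)
proof (induction k rule: less_induct)
  case (less k)
  then obtain l where k: "k = Suc l" by (metis odd_pos gr0_conv_Suc)
  have "(\<Sum>i\<le>l. (\<Sum>x\<in>#M. x ^ Suc i) * chom (int (l - i)) M) \<le> 0"
  proof (rule sum_nonpos)
    fix i assume "i \<in> {..l}"
    hence i: "i \<le> l" by simp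
    show "(\<Sum>x\<in>#M. x ^ Suc i) * chom (int (l - i)) M \<le> 0"
    proof (cases "even i")
      case True
      hence "(\<Sum>x\<in>#M. x ^ Suc i) \<le> 0" using assms(1)[of "Suc i"] by simp
      moreover have "chom (int (l - i)) M \<ge> 0"
        using True less.prems k i by (intro chom_even_nonneg) auto
      ultimately show ?thesis by (rule mult_nonpos_nonneg)
    next
      case False
      hence "(\<Sum>x\<in>#M. 0) \<le> (\<Sum>x\<in>#M. x ^ Suc i)"
        by (intro sum_mset_mono) (auto simp: zero_le_even_power simp del: power_Suc)
      moreover have "chom (int (l - i)) M \<le> 0"
        using False less.prems k i by (intro less.IH) auto
      ultimately show ?thesis by (simp add: mult_nonneg_nonpos)
    qed
  qed
  hence "real k * chom (int k) M \<le> 0" using chom_newton[of l M] k by simp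
  then show ?case using k by (simp add: mult_le_0_iff)
qed

text \<open>
  Write \<open>w(x) = h_m(M, x)\<close>, a convex function, so that \<open>w(x) = \<mu> + l/x\<close> at the nonzero entries.
  If \<open>l = 0\<close>, only an entry 0 is of interest, and it lies between a negative and a positive entry, at
  which \<open>w\<close> equals \<open>\<mu>\<close>.
  
  Let \<open>l > 0\<close>.  Then \<open>w < \<mu>\<close> at the negative entries and \<open>w > \<mu>\<close> at the positive ones.  Beyond a
  negative entry the convex \<open>w\<close> therefore increases along the positive entries while \<open>\<mu> + l/x\<close>
  decreases, so all positive entries equal one number \<open>X\<close>.  The claim becomes \<open>\<Sum>x\<in>M. 1/x \<le> 0\<close>.
  If there are at least as many negative as positive entries, this is the inequality between
  arithmetic and harmonic means.  If there are fewer, then their odd power sums outweigh those of the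
  positive entries, whence \<open>w(X) \<le> w(-X)\<close>; but some entry \<open>v\<close> is below \<open>-X\<close>, and \<open>w(v) < w(X)\<close>
  with convexity gives \<open>w(-X) < w(X)\<close>.
\<close>

lemma critical_sum_le_nonneg:
  assumes m: "even m" "m \<ge> 0" and sum: "\<Sum>\<^sub># M = 0" and nz: "x0 \<in># M" "x0 \<noteq> 0"
    and crit: "\<And>x. x \<in># M \<Longrightarrow> x * chom m (add_mset x M) = l + \<mu> * x"
    and l: "l \<ge> 0"
  shows "(\<Sum>x\<in>#M. chom m (add_mset x M)) \<le> real (size M) * \<mu>"
proof -
  let ?w = "\<lambda>x. chom m (add_mset x M)"
  obtain u X where u: "u \<in># M" "u < 0" and X: "X \<in># M" "X > 0"
    using sum_mset_zero_signs[OF sum nz] by blast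
  have w: "?w x = \<mu> + l / x" if "x \<in># M" "x \<noteq> 0" for x
  proof -
    have "?w x = (x * ?w x) / x" using that(2) by simp
    also have "\<dots> = \<mu> + l / x"
      unfolding crit[OF that(1)] using that(2) by (simp add: add_divide_distrib)
    finally show ?thesis .
  qed
  show ?thesis
  proof (cases "l = 0")
    case True
    have "?w x \<le> \<mu>" if "x \<in># M" for x
    proof (cases "x = 0")
      case x: True
      have "(X - u) * ?w 0 \<le> (X - 0) * ?w u + (0 - u) * ?w X"
        using u X m by (intro chom_convex) auto
      also have "\<dots> = (X - u) * \<mu>"
        using w[of u] w[of X] u X True by (simp add: algebra_simps)
      finally show ?thesis using x u X by simp
    qed (use w[OF that] True in auto)
    hence "(\<Sum>x\<in>#M. ?w x) \<le> (\<Sum>x\<in>#M. \<mu>)" by (rule sum_mset_mono)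
    then show ?thesis by simp
  next
    case False
    with l have l: "l > 0" by simp
    have nz: "x \<noteq> 0" if "x \<in># M" for x using crit[OF that] l by auto
    have below: "?w x < \<mu>" if "x \<in># M" "x < 0" for x
      using w[OF that(1)] that(2) divide_pos_neg[OF l that(2)] by linarith
    have above: "?w x > \<mu>" if "x \<in># M" "x > 0" for x
      using w[OF that(1)] that(2) divide_pos_pos[OF l that(2)] by linarith
    have uniq': "\<not> x < y" if "x \<in># M" "x > 0" "y \<in># M" for x y
    proof
      assume "x < y"
      have "?w u < ?w y"
        using below[OF u] above[OF that(3)] that(2) \<open>x < y\<close> by linarith
      with \<open>x < y\<close> have "?w x < ?w y"
        using that(2) u(2) chom_less_right_end[OF m(1), of u x y M] by linarith
      moreover have "l / y < l / x" using \<open>x < y\<close> that l by (intro divide_strict_left_mono) auto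
      moreover have "?w x = \<mu> + l / x" "?w y = \<mu> + l / y"
        using that \<open>x < y\<close> by (intro w; simp)+
      ultimately show False by linarith
    qed
    have uniq: "x = X" if "x \<in># M" "x > 0" for x
      using uniq'[OF that X(1)] uniq'[OF X that(1)] by linarith
    \<comment> \<open>The number of positive entries minus the number of negative ones.\<close>
    define s where "s = (\<Sum>x\<in>#M. sgn x)"
    have "(\<Sum>x\<in>#M. 1 / x) \<le> 0"
    proof (cases "s \<le> 0")
      case True
      \<comment> \<open>For \<open>x < 0\<close> the right-hand side is the tangent of \<open>1/x\<close> at \<open>-X\<close>, and at \<open>x = X\<close> equality holds.\<close>
      have "1 / x \<le> 2 / X * sgn x - 1 / X\<^sup>2 * x" if "x \<in># M" for x
      proof (cases "x > 0")
        case False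
        with nz[OF that] have x: "x < 0" by linarith
        have "0 \<le> (x + X)\<^sup>2 / (X\<^sup>2 * (- x))"
          using x by (intro divide_nonneg_nonneg mult_nonneg_nonneg) auto
        also have "\<dots> = - 1 / x - 2 / X - x / X\<^sup>2"
          using x X by (simp add: field_simps power2_eq_square)
        finally show ?thesis using x by simp
      qed (use uniq[OF that] in \<open>simp add: field_simps power2_eq_square\<close>)
      hence "(\<Sum>x\<in>#M. 1 / x) \<le> (\<Sum>x\<in>#M. 2 / X * sgn x - 1 / X\<^sup>2 * x)"
        by (rule sum_mset_mono)
      also have "\<dots> = 2 / X * s - 1 / X\<^sup>2 * \<Sum>\<^sub># M"
        unfolding s_def by (induction M) (simp_all add: algebra_simps add_divide_distrib)
      also have "\<dots> \<le> 0" using True X sum by (simp add: mult_le_0_iff divide_nonpos_pos)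
      finally show ?thesis .
    next
      case False
      have odd_le: "(\<Sum>x\<in>#M. x ^ i) \<le> 0" if "odd i" for i
      proof -
        have Xi: "X ^ i = X * X ^ (i - 1)"
          using power_minus_mult[OF odd_pos[OF \<open>odd i\<close>], of X] by (simp only: mult.commute)
        \<comment> \<open>Again the tangent at \<open>-X\<close> for \<open>x < 0\<close>, and an equality at \<open>x = X\<close>.\<close>
        have "x ^ i \<le> real i * X ^ (i - 1) * x - (real i - 1) * X ^ i * sgn x" if "x \<in># M" for x
        proof (cases "x > 0")
          case False
          with nz[OF that] have x: "x < 0" by linarith
          have "1 + real i * (- x / X - 1) \<le> (1 + (- x / X - 1)) ^ i"
            using x X by (intro Bernoulli_inequality) (auto simp: divide_nonpos_pos)
          hence "X ^ i * (1 + real i * (- x / X - 1)) \<le> X ^ i * (- x / X) ^ i"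
            using X by (intro mult_left_mono) auto
          also have "\<dots> = (- x) ^ i" using X by (simp flip: power_mult_distrib)
          also have "\<dots> = - (x ^ i)" using \<open>odd i\<close> by simp
          finally have "x ^ i \<le> - (X ^ i * (1 + real i * (- x / X - 1)))" by simp
          also have "\<dots> = real i * X ^ (i - 1) * x - (real i - 1) * X ^ i * (- 1)"
          proof -
            have "- (X * Y * (1 + real i * (- x / X - 1)))
                = real i * Y * x - (real i - 1) * (X * Y) * (- 1)" for Y
              using X by (simp add: field_simps)
            then show ?thesis using Xi by simp
          qed
          finally show ?thesis using x by simp
        next
          case True
          have "x ^ i = real i * (X * X ^ (i - 1)) - (real i - 1) * X ^ i"
            using uniq[OF that True] unfolding Xi[symmetric] by (simp add: algebra_simps)
          then show ?thesis using uniq[OF that True] X by (simp add: mult.commute mult.left_commute)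
        qed
        hence "(\<Sum>x\<in>#M. x ^ i) 
            \<le> (\<Sum>x\<in>#M. real i * X ^ (i - 1) * x - (real i - 1) * X ^ i * sgn x)"
          by (rule sum_mset_mono)
        also have "\<dots> = real i * X ^ (i - 1) * \<Sum>\<^sub># M - (real i - 1) * X ^ i * s"
          unfolding s_def by (induction M) (simp_all add: algebra_simps)
        also have "\<dots> \<le> 0" using False X sum \<open>odd i\<close> odd_pos[of i] by (simp add: Suc_leI)
        finally show ?thesis .
      qed
      have "chom (m - 1) (add_mset X (add_mset (- X) M)) \<le> 0"
      proof (cases "m = 0")
        case nz: False
        with m have "odd (nat (m - 1))" "m - 1 = int (nat (m - 1))"
          by (auto simp: even_nat_iff)
        moreover have "chom (int (nat (m - 1))) (add_mset X (add_mset (- X) M)) \<le> 0"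
          using odd_le calculation(1) by (intro chom_odd_nonpos) simp_all
        ultimately show ?thesis by simp
      qed (simp add: chom_neg)
      hence refl: "?w X \<le> ?w (- X)"
        using chom_diff[of m X M "- X"] X mult_nonneg_nonpos[of "X - - X"] by fastforce
      have "\<exists>v\<in>#M. v < - X"
      proof (rule ccontr)
        assume "\<not> (\<exists>v\<in>#M. v < - X)"
        hence "X * sgn x \<le> x" if "x \<in># M" for x
          using that nz[OF that] uniq[OF that] by (cases "x > 0") force+
        hence "(\<Sum>x\<in>#M. X * sgn x) \<le> (\<Sum>x\<in>#M. x)" by (rule sum_mset_mono)
        hence "X * s \<le> 0" using sum by (simp add: s_def sum_mset_distrib_left)
        with False X show False by (simp add: mult_le_0_iff)
      qed
      then obtain v where v: "v \<in># M" "v < - X" by blast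
      have "?w v < ?w X"
        using below[OF v(1)] above[OF X] v(2) X(2) by linarith
      hence "?w (- X) < ?w X"
        using v(2) X(2) chom_less_right_end[OF m(1), of v "- X" X M] by linarith
      with refl show ?thesis by simp
    qed
    hence "l * (\<Sum>x\<in>#M. 1 / x) \<le> 0" using l by (simp add: mult_le_0_iff)
    moreover have "(\<Sum>x\<in>#M. ?w x) = (\<Sum>x\<in>#M. \<mu> + l * (1 / x))"
      using w nz by (intro arg_cong[of _ _ sum_mset] image_mset_cong) auto
    moreover have "\<dots> = real (size M) * \<mu> + l * (\<Sum>x\<in>#M. 1 / x)"
      unfolding sum_mset.distrib sum_mset_distrib_left by simp
    ultimately show ?thesis by simp
  qed
qed

text \<open>
  Negating all entries changes the sign of \<open>l\<close> and, the degree being even, preserves \<open>w\<close>.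
\<close>

lemma critical_sum_le:
  assumes m: "even m" "m \<ge> 0" and sum: "\<Sum>\<^sub># M = 0" and nz: "x0 \<in># M" "x0 \<noteq> 0"
    and crit: "\<And>x. x \<in># M \<Longrightarrow> x * chom m (add_mset x M) = l + \<mu> * x"
  shows "(\<Sum>x\<in>#M. chom m (add_mset x M)) \<le> real (size M) * \<mu>"
proof (cases "l \<ge> 0")
  case True
  with assms show ?thesis by (intro critical_sum_le_nonneg) auto
next
  case False
  let ?N = "image_mset uminus M"
  have w: "chom m (add_mset (- x) ?N) = chom m (add_mset x M)" for x
    using chom_uminus_even[OF m(1), of "add_mset x M"] by simp
  have "(\<Sum>x\<in>#?N. chom m (add_mset x ?N)) \<le> real (size ?N) * \<mu>"
  proof (rule critical_sum_le_nonneg[OF m])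
    show "\<Sum>\<^sub># ?N = 0" using sum by (simp add: sum_mset_uminus)
    show "- x0 \<in># ?N" "- x0 \<noteq> 0" "- l \<ge> 0" using nz False by auto
    show "x * chom m (add_mset x ?N) = - l + \<mu> * x" if "x \<in># ?N" for x
      using that crit w by fastforce
  qed
  then show ?thesis by (simp add: multiset.map_comp comp_def w)
qed

section \<open>The minimum\<close>

text \<open>
  The partial derivative of \<open>h_m\<close> in \<open>a_i\<close> is \<open>h_{m-1}\<close> of the vector with \<open>a_i\<close> repeated.  The
  proof differentiates the recursion of \<open>chom_add_mset\<close>.
\<close>

lemma DERIV_chom_line:
  "((\<lambda>t. chom (int m) (coords n (\<lambda>i. a i + t * d i))) has_real_derivative
     (\<Sum>i=1..n. d i * chom (int m - 1)
        (add_mset (a i + t * d i) (coords n (\<lambda>i. a i + t * d i))))) (at t)"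
proof (induction n arbitrary: m)
  case 0
  then show ?case by (simp add: coords_def)
next
  case (Suc n)
  note IHn = Suc.IH
  let ?C = "\<lambda>n t. coords n (\<lambda>i. a i + t * d i)" and ?b = "\<lambda>i. a i + t * d i"
  show ?case
  proof (induction m)
    case (Suc m)
    let ?e = "\<lambda>m. \<Sum>i=1..Suc n. d i * chom (int m - 1) (add_mset (?b i) (?C (Suc n) t))"
    have step: "chom (int (Suc m)) (?C (Suc n) t)
        = chom (int (Suc m)) (?C n t) + (a (Suc n) + t * d (Suc n)) * chom (int m) (?C (Suc n) t)" for t
      using chom_add_mset[of "int (Suc m)" "a (Suc n) + t * d (Suc n)" "?C n t"]
      by (simp add: coords_Suc)
    have "(\<Sum>i=1..n. d i * chom (int m) (add_mset (?b i) (?C (Suc n) t)))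
        = (\<Sum>i=1..n. d i * chom (int m) (add_mset (?b i) (?C n t)))
          + ?b (Suc n) * (\<Sum>i=1..n. d i * chom (int m - 1) (add_mset (?b i) (?C (Suc n) t)))"
    proof -
      have "chom (int m) (add_mset (?b i) (?C (Suc n) t)) = chom (int m) (add_mset (?b i) (?C n t))
          + ?b (Suc n) * chom (int m - 1) (add_mset (?b i) (?C (Suc n) t))" for i
        using chom_add_mset[of "int m" "?b (Suc n)" "add_mset (?b i) (?C n t)"]
        by (simp add: coords_Suc add_mset_commute)
      then show ?thesis by (simp add: algebra_simps sum.distrib sum_distrib_left)
    qed
    moreover have "chom (int m) (add_mset (?b (Suc n)) (?C (Suc n) t)) = chom (int m) (?C (Suc n) t)
        + ?b (Suc n) * chom (int m - 1) (add_mset (?b (Suc n)) (?C (Suc n) t))"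
      by (rule chom_add_mset)
    ultimately have eq: "?e (Suc m)
        = (\<Sum>i=1..n. d i * chom (int (Suc m) - 1) (add_mset (?b i) (?C n t)))
          + (d (Suc n) * chom (int m) (?C (Suc n) t) + ?e m * ?b (Suc n))"
      by (simp add: algebra_simps)
    have "((\<lambda>t. a (Suc n) + t * d (Suc n)) has_real_derivative d (Suc n)) (at t)"
      by (auto intro!: derivative_eq_intros)
    from DERIV_add[OF IHn[of "Suc m"] DERIV_mult[OF this Suc.IH]]
    show ?case unfolding step eq by simp
  qed (simp add: chom_0 chom_neg)
qed

text \<open>
  A lower bound at the centred unit vectors extends to all centred ones by homogeneity.
\<close>

lemma chom_ge_sphere_min:
  assumes min: "\<And>N. centred_unit_mset N \<Longrightarrow> size N = n \<Longrightarrow> c \<le> chom (int (2 * k)) N"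
    and "size N = n" "\<Sum>\<^sub># N = 0" "(\<Sum>x\<in>#N. x\<^sup>2) = s" "s > 0"
  shows "c * s ^ k \<le> chom (int (2 * k)) N"
proof -
  let ?r = "1 / sqrt s"
  have "c \<le> chom (int (2 * k)) (image_mset ((*) ?r) N)"
  proof (rule min)
    have "(\<Sum>x\<in>#image_mset ((*) ?r) N. x\<^sup>2) = (\<Sum>x\<in>#N. ?r\<^sup>2 * x\<^sup>2)"
      by (simp add: multiset.map_comp comp_def power_divide power_mult_distrib)
    also have "\<dots> = ?r\<^sup>2 * s" using assms by (simp flip: sum_mset_distrib_left)
    also have "\<dots> = 1" using assms by (simp add: power_divide)
    finally have "(\<Sum>x\<in>#image_mset ((*) ?r) N. x\<^sup>2) = 1" .
    moreover have "\<Sum>\<^sub># (image_mset ((*) ?r) N) = ?r * \<Sum>\<^sub># N"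
      by (induction N) (simp_all add: add_divide_distrib)
    ultimately show "centred_unit_mset (image_mset ((*) ?r) N)"
      using assms by (simp add: centred_unit_mset_def)
  qed (use assms in simp)
  also have "\<dots> = (?r\<^sup>2) ^ k * chom (int (2 * k)) N"
    by (simp only: chom_scale power_mult)
  also have "?r\<^sup>2 = 1 / s" using assms by (simp add: power_divide)
  finally show ?thesis using assms by (simp add: power_divide field_simps)
qed

text \<open>
  The first-order condition at a constrained minimiser, for a direction \<open>d\<close> tangent to both
  constraints.  The line \<open>a + t d\<close> leaves the sphere, but homogeneity turns minimality into
  \<open>h_{2k}(a + t d) \<ge> h_{2k}(a) (1 + t\<^sup>2 |d|\<^sup>2)^k\<close> for all \<open>t\<close>, with equality at \<open>t = 0\<close>.
\<close>

lemma minimiser_orthogonal: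
  assumes a: "centred_unit_mset (coords n a)"
    and min: "\<And>N. centred_unit_mset N \<Longrightarrow> size N = n \<Longrightarrow>
                chom (int (2 * k)) (coords n a) \<le> chom (int (2 * k)) N"
    and d: "(\<Sum>i=1..n. d i) = 0" "(\<Sum>i=1..n. a i * d i) = 0"
  shows "(\<Sum>i=1..n. d i * chom (int (2 * k) - 1) (add_mset (a i) (coords n a))) = 0"
proof -
  let ?c = "chom (int (2 * k)) (coords n a)" and ?D = "\<Sum>i=1..n. (d i)\<^sup>2"
  define \<phi> where "\<phi> = (\<lambda>t. chom (int (2 * k)) (coords n (\<lambda>i. a i + t * d i)) - ?c * (1 + t\<^sup>2 * ?D) ^ k)"
  have a': "(\<Sum>i=1..n. (a i)\<^sup>2) = 1" "(\<Sum>i=1..n. a i) = 0"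
    using a by (simp_all add: centred_unit_coords centred_unit_vector_def)
  have "\<phi> t \<ge> 0" for t
  proof -
    have "\<Sum>\<^sub># (coords n (\<lambda>i. a i + t * d i)) = (\<Sum>i=1..n. a i) + t * (\<Sum>i=1..n. d i)"
      using sum_coords[of "\<lambda>x. x" n "\<lambda>i. a i + t * d i"]
      by (simp add: sum.distrib sum_distrib_left)
    moreover have "(\<Sum>x\<in>#coords n (\<lambda>i. a i + t * d i). x\<^sup>2)
        = (\<Sum>i=1..n. (a i)\<^sup>2) + 2 * t * (\<Sum>i=1..n. a i * d i) + t\<^sup>2 * ?D"
      by (simp add: sum_coords power2_eq_square algebra_simps sum.distrib sum_distrib_left)
    moreover have "1 + t\<^sup>2 * ?D > 0" by (intro add_pos_nonneg mult_nonneg_nonneg sum_nonneg) auto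
    ultimately have "?c * (1 + t\<^sup>2 * ?D) ^ k \<le> chom (int (2 * k)) (coords n (\<lambda>i. a i + t * d i))"
      using a' d by (intro chom_ge_sphere_min[OF min]) simp_all
    then show ?thesis by (simp add: \<phi>_def)
  qed
  moreover have "\<phi> 0 = 0" by (simp add: \<phi>_def)
  moreover have "(\<phi> has_real_derivative
      (\<Sum>i=1..n. d i * chom (int (2 * k) - 1) (add_mset (a i) (coords n a)))) (at 0)"
  proof -
    have "((\<lambda>t. ?c * (1 + t\<^sup>2 * ?D) ^ k) has_real_derivative 0) (at 0)"
      by (auto intro!: derivative_eq_intros)
    from DERIV_diff[OF DERIV_chom_line[of "2 * k" n a d 0] this] show ?thesis
      by (simp add: \<phi>_def[abs_def])
  qed
  ultimately show ?thesis using DERIV_local_min[of \<phi> _ 0 1] by auto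
qed

text \<open>
  Lagrange multipliers.  The gradient \<open>f\<close> is orthogonal to every tangent direction, in particular to
  its own tangent part \<open>d\<close>, so \<open>d = 0\<close>.  The multiplier \<open>\<mu>\<close> of the sphere is found from Euler's
  identity.
\<close>

lemma minimiser_critical:
  assumes M: "centred_unit_mset M" "size M = n"
    and min: "\<And>N. centred_unit_mset N \<Longrightarrow> size N = n \<Longrightarrow>
                chom (int (2 * k)) M \<le> chom (int (2 * k)) N"
  obtains l where "\<And>x. x \<in># M \<Longrightarrow>
    x * chom (int (2 * k) - 2) (add_mset x M) = l + real (2 * k) * chom (int (2 * k)) M * x"
proof -
  obtain a where a: "coords n a = M" using obtain_coords[OF M(2)] .
  have a': "(\<Sum>i=1..n. (a i)\<^sup>2) = 1" "(\<Sum>i=1..n. a i) = 0"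
    using M unfolding a[symmetric] by (simp_all add: centred_unit_coords centred_unit_vector_def)
  have "n > 0" using a'(1) by (cases n) auto
  define f where "f = (\<lambda>i. chom (int (2 * k) - 1) (add_mset (a i) M))"
  define \<mu> where "\<mu> = real (2 * k) * chom (int (2 * k)) M"
  define \<nu> where "\<nu> = (\<Sum>i=1..n. f i) / n"
  define d where "d = (\<lambda>i. f i - \<nu> - \<mu> * a i)"
  have \<mu>: "(\<Sum>i=1..n. a i * f i) = \<mu>"
    using chom_euler[where M = M and m = "int (2 * k)"] 
    by (simp add: \<mu>_def f_def a[symmetric] sum_coords)
  have d0: "(\<Sum>i=1..n. d i) = 0"
    using a' \<open>n > 0\<close> by (simp add: d_def sum_subtractf \<nu>_def flip: sum_distrib_left)
  have "(\<Sum>i=1..n. a i * d i)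
      = (\<Sum>i=1..n. a i * f i) - \<nu> * (\<Sum>i=1..n. a i) - \<mu> * (\<Sum>i=1..n. (a i)\<^sup>2)"
    by (simp add: d_def algebra_simps sum_subtractf sum.distrib sum_distrib_left power2_eq_square)
  hence d1: "(\<Sum>i=1..n. a i * d i) = 0" using a' \<mu> by simp
  have "(\<Sum>i=1..n. d i * f i) = 0"
    using minimiser_orthogonal[of n a k d] M min d0 d1 by (simp add: f_def a)
  moreover have "(\<Sum>i=1..n. (d i)\<^sup>2)
      = (\<Sum>i=1..n. d i * f i) - \<nu> * (\<Sum>i=1..n. d i) - \<mu> * (\<Sum>i=1..n. a i * d i)"
    by (simp add: d_def algebra_simps sum_subtractf sum.distrib sum_distrib_left power2_eq_square)
  ultimately have "(\<Sum>i=1..n. (d i)\<^sup>2) = 0" using d0 d1 by simp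
  hence "d i = 0" if "i \<in> {1..n}" for i using that by (subst (asm) sum_nonneg_eq_0_iff) auto
  hence f: "f i = \<nu> + \<mu> * a i" if "i \<in> {1..n}" for i using that by (force simp: d_def)
  show ?thesis
  proof
    fix x assume "x \<in># M"
    then obtain i where i: "i \<in> {1..n}" "x = a i" unfolding a[symmetric] in_coords_iff by blast
    have "f i = chom (int (2 * k) - 1) M + x * chom (int (2 * k) - 2) (add_mset x M)"
      using chom_add_mset[of "int (2 * k) - 1" x M] by (simp add: f_def i)
    with f[OF i(1)] show "x * chom (int (2 * k) - 2) (add_mset x M)
        = (\<nu> - chom (int (2 * k) - 1) M) + real (2 * k) * chom (int (2 * k)) M * x"
      by (simp add: \<mu>_def i)
  qed
qed

lemma pochhammer_quotient_Suc:
  assumes "n > 0"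
  shows "pochhammer (real n / 2) (Suc k) / (fact (Suc k) * real n ^ Suc k)
    = (real n + 2 * real k) / (real (2 * Suc k) * real n) *
      (pochhammer (real n / 2) k / (fact k * real n ^ k))"
  using assms by (simp add: pochhammer_Suc field_simps)

text \<open>
  At a minimiser of \<open>h_{2k+2}\<close> the multiplier \<open>\<mu> = (2k+2) h_{2k+2}\<close> is at least the mean of the
  \<open>h_{2k}(M, x)\<close>, which is \<open>(n + 2k) h_{2k}(M) / n\<close>, and \<open>h_{2k}(M)\<close> is bounded below by the
  induction hypothesis.
\<close>

lemma chom_lower_bound:
  assumes "centred_unit_mset M" "size M = n"
  shows "pochhammer (real n / 2) k / (fact k * real n ^ k) \<le> chom (int (2 * k)) M"
  using assms
proof (induction k arbitrary: M)
  case 0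
  then show ?case by (simp add: chom_0)
next
  case (Suc k)
  obtain L where L: "centred_unit_mset L" "size L = n"
    "\<And>N. centred_unit_mset N \<Longrightarrow> size N = n \<Longrightarrow> chom (int (2 * Suc k)) L \<le> chom (int (2 * Suc k)) N"
    using exists_chom_maximiser[OF Suc.prems, of "-1" "2 * Suc k" 0 0] by auto
  let ?c = "chom (int (2 * Suc k)) L" and ?w = "\<lambda>x. chom (int (2 * k)) (add_mset x L)"
  have idx: "int (2 * Suc k) - 2 = int (2 * k)" by simp
  obtain l where l: "\<And>x. x \<in># L \<Longrightarrow> x * ?w x = l + real (2 * Suc k) * ?c * x"
    using minimiser_critical[OF L] unfolding idx by blast
  obtain x0 where x0: "x0 \<in># L" "x0 \<noteq> 0"
    using centred_unit_mset_nonzero[OF L(1)] by blast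
  hence "n > 0" using L(2) by (auto simp: gr0_conv_Suc dest: multi_member_split)
  have "(real n + 2 * real k) * chom (int (2 * k)) L = (\<Sum>x\<in>#L. ?w x)"
    by (simp add: sum_chom_add_mset L)
  also have "\<dots> \<le> real n * (real (2 * Suc k) * ?c)"
    using critical_sum_le[of "int (2 * k)" L x0 l "real (2 * Suc k) * ?c"] x0 l L
    by (simp add: centred_unit_mset_def)
  finally have step: "(real n + 2 * real k) / (real (2 * Suc k) * real n) * chom (int (2 * k)) L \<le> ?c"
    using \<open>n > 0\<close> by (simp add: field_simps del: of_nat_Suc)
  have "pochhammer (real n / 2) (Suc k) / (fact (Suc k) * real n ^ Suc k)
      = (real n + 2 * real k) / (real (2 * Suc k) * real n) *
        (pochhammer (real n / 2) k / (fact k * real n ^ k))"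
    by (rule pochhammer_quotient_Suc[OF \<open>n > 0\<close>])
  also have "\<dots> \<le> (real n + 2 * real k) / (real (2 * Suc k) * real n) * chom (int (2 * k)) L"
    using Suc.IH[OF L(1,2)] by (intro mult_left_mono) auto
  also note step
  also have "?c \<le> chom (int (2 * Suc k)) M" using L(3)[OF Suc.prems] .
  finally show ?case .
qed

lemma centred_min_vector:
  assumes "even n" "n > 0"
  shows "centred_unit_vector n (min_vector n)"
proof -
  obtain h where n: "n = h + h" using assms(1) by (auto elim!: evenE simp: mult_2)
  have "(\<Sum>i=1..n. min_vector n i) = (\<Sum>i=1..h. min_vector n i) + (\<Sum>i=h+1..h+h. min_vector n i)"
    unfolding n by (subst sum.ub_add_nat) simp_all
  also have "(\<Sum>i=1..h. min_vector n i) = (\<Sum>i=1..h. 1 / sqrt (real n))"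
    by (intro sum.cong) (auto simp: min_vector_def n)
  also have "(\<Sum>i=h+1..h+h. min_vector n i) = (\<Sum>i=h+1..h+h. - 1 / sqrt (real n))"
    by (intro sum.cong) (auto simp: min_vector_def n)
  finally have "(\<Sum>i=1..n. min_vector n i) = 0" by simp
  moreover have "(\<Sum>i=1..n. (min_vector n i)\<^sup>2) = 1"
  proof -
    have "(min_vector n i)\<^sup>2 = 1 / real n" for i by (simp add: min_vector_def power_divide)
    thus ?thesis using assms(2) by simp
  qed
  ultimately show ?thesis by (simp add: centred_unit_vector_def)
qed

text \<open>
  Euler's identity expresses \<open>h_{2k+2}\<close> by the sum of the \<open>h_{2k}(M, x)\<close>, so here the recursion behind
  \<open>chom_lower_bound\<close> is an equality.
\<close>

lemma chom_constant_squares: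
  assumes "\<Sum>\<^sub># M = 0" "size M = n" "n > 0" "\<And>x. x \<in># M \<Longrightarrow> x\<^sup>2 = 1 / real n"
  shows "chom (int (2 * k)) M = pochhammer (real n / 2) k / (fact k * real n ^ k)"
proof (induction k)
  case (Suc k)
  have idx: "int (2 * Suc k) - 2 = int (2 * k)" by simp
  have "real (2 * Suc k) * chom (int (2 * Suc k)) M
      = (\<Sum>y\<in>#M. y\<^sup>2 * chom (int (2 * k)) (add_mset y M))"
    using chom_euler_squares[OF assms(1), of "int (2 * Suc k)"] unfolding idx by simp
  also have "\<dots> = (\<Sum>y\<in>#M. 1 / real n * chom (int (2 * k)) (add_mset y M))"
    by (intro arg_cong[of _ _ sum_mset] image_mset_cong) (simp add: assms(4))
  also have "\<dots> = 1 / real n * (real n + 2 * real k) * chom (int (2 * k)) M"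
    unfolding sum_mset_distrib_left[symmetric] sum_chom_add_mset by (simp add: assms(2))
  finally have "chom (int (2 * Suc k)) M
      = (real n + 2 * real k) / (real (2 * Suc k) * real n) * chom (int (2 * k)) M"
    using assms(3) by (simp add: field_simps del: of_nat_Suc)
  then show ?case unfolding Suc.IH pochhammer_quotient_Suc[OF assms(3)] .
qed (simp add: chom_0)

lemma fact_quotient_eq_pochhammer:
  assumes "even n" "n > 0"
  shows "fact (n div 2 + k - 1) / (fact k * fact (n div 2 - 1) * real n ^ k)
    = pochhammer (real n / 2) k / (fact k * real n ^ k)"
proof -
  obtain h where h: "n = 2 * Suc h" using assms by (metis evenE gr0_conv_Suc mult_0_right not_gr0)
  have "(fact (h + k) :: real) = fact h * pochhammer (real (Suc h)) k"
    using pochhammer_product[of h "h + k" "1 :: real"] by (simp add: pochhammer_fact add.commute)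
  moreover have "real n / 2 = real (Suc h)" "n div 2 + k - 1 = h + k" "n div 2 - 1 = h"
    using h by simp_all
  ultimately show ?thesis by (simp only: mult.commute[of _ "fact h"] mult.assoc) simp
qed

section \<open>The maximum\<close>

text \<open>
  For \<open>j = 0\<close> this is the perturbed objective \<open>h_{2k} + \<epsilon> h_6\<close>.  The parameter \<open>j\<close> is the number of
  degrees lost by divided differences.  The summand \<open>\<epsilon> h_{6-j}\<close> keeps the value positive for even \<open>j\<close>
  up to 6 (unless all entries vanish), also when \<open>2k - j\<close> is negative.
\<close>

definition pchom :: "real \<Rightarrow> nat \<Rightarrow> int \<Rightarrow> real multiset \<Rightarrow> real" where
  "pchom \<epsilon> k j M = chom (int (2 * k) - j) M + \<epsilon> * chom (6 - j) M"

lemma pchom_exchange: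
  assumes "x' + y' + z' = x + y + z" "x' * y' + y' * z' + z' * x' = x * y + y * z + z * x"
  shows "pchom \<epsilon> k j (N + {#x', y', z'#}) - pchom \<epsilon> k j (N + {#x, y, z#})
     = (x' * y' * z' - x * y * z) * pchom \<epsilon> k (j + 3) (N + {#x, y, z#} + {#x', y', z'#})"
proof -
  note ex = chom_exchange[OF assms, of _ N]
  have "pchom \<epsilon> k j (N + {#x', y', z'#}) - pchom \<epsilon> k j (N + {#x, y, z#})
      = (chom (int (2 * k) - j) (N + {#x', y', z'#}) - chom (int (2 * k) - j) (N + {#x, y, z#}))
        + \<epsilon> * (chom (6 - j) (N + {#x', y', z'#}) - chom (6 - j) (N + {#x, y, z#}))"
    by (simp only: pchom_def algebra_simps)
  then show ?thesis
    unfolding ex pchom_def by (simp only: algebra_simps diff_diff_eq)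
qed

lemma pchom_diff:
  "pchom \<epsilon> k j (add_mset x M) - pchom \<epsilon> k j (add_mset y M)
     = (x - y) * pchom \<epsilon> k (j + 1) (add_mset x (add_mset y M))"
proof -
  have "pchom \<epsilon> k j (add_mset x M) - pchom \<epsilon> k j (add_mset y M)
      = (chom (int (2 * k) - j) (add_mset x M) - chom (int (2 * k) - j) (add_mset y M))
        + \<epsilon> * (chom (6 - j) (add_mset x M) - chom (6 - j) (add_mset y M))"
    by (simp only: pchom_def algebra_simps)
  then show ?thesis
    unfolding chom_diff pchom_def by (simp only: algebra_simps diff_diff_eq)
qed

lemma pchom_pos:
  assumes "even j" "j \<le> 6" "\<epsilon> > 0" "x \<in># M" "x \<noteq> 0"
  shows "pchom \<epsilon> k j M > 0"
  unfolding pchom_def using assms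
  by (intro add_nonneg_pos chom_even_nonneg mult_pos_pos chom_even_pos[of _ x]) auto

lemma pchom_3_strict_mono:
  assumes "\<epsilon> > 0" "x \<in># M" "x \<noteq> 0" "y < y'"
  shows "pchom \<epsilon> k 3 (add_mset y M) < pchom \<epsilon> k 3 (add_mset y' M)"
proof -
  have "pchom \<epsilon> k (3 + 1) (add_mset y' (add_mset y M)) > 0"
    using assms by (intro pchom_pos[of _ _ x]) auto
  hence "(y' - y) * pchom \<epsilon> k (3 + 1) (add_mset y' (add_mset y M)) > 0"
    using assms by simp
  thus ?thesis unfolding pchom_diff[symmetric] by simp
qed

locale pchom_maximiser =
  fixes \<epsilon> :: real and k :: nat and M :: "real multiset"
  assumes eps: "\<epsilon> > 0" and centred: "centred_unit_mset M"
    and maximal: "\<And>N. centred_unit_mset N \<Longrightarrow> size N = size M \<Longrightarrow> pchom \<epsilon> k 0 N \<le> pchom \<epsilon> k 0 M"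
begin

text \<open>
  The new triple has the same sum and sum of squares, so it gives an admissible competitor.
\<close>

lemma exchange_le:
  assumes M: "M = N + {#x, y, z#}"
    and e: "x' + y' + z' = x + y + z" "x' * y' + y' * z' + z' * x' = x * y + y * z + z * x"
  shows "(x' * y' * z' - x * y * z) * pchom \<epsilon> k 3 (M + {#x', y', z'#}) \<le> 0"
proof -
  have "x'\<^sup>2 + y'\<^sup>2 + z'\<^sup>2 = x\<^sup>2 + y\<^sup>2 + z\<^sup>2"
  proof -
    have sq: "a\<^sup>2 + b\<^sup>2 + c\<^sup>2 = (a + b + c)\<^sup>2 - 2 * (a * b + b * c + c * a)" for a b c :: real
      by algebra
    show ?thesis unfolding sq e ..
  qed
  with centred e have "centred_unit_mset (N + {#x', y', z'#})"
    by (simp add: centred_unit_mset_def M algebra_simps)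
  with maximal have "pchom \<epsilon> k 0 (N + {#x', y', z'#}) - pchom \<epsilon> k 0 (N + {#x, y, z#}) \<le> 0"
    by (simp add: M)
  thus ?thesis unfolding pchom_exchange[OF e] M by simp
qed

text \<open>
  Among the triples with given sum and sum of squares the product is extreme exactly when two entries
  agree.  The product of \<open>x, y, z\<close> is thus strictly between those of the extreme triples \<open>P\<close> and
  \<open>Q\<close>.  Maximality makes the difference quotient of the objective nonpositive towards \<open>P\<close> and
  nonnegative towards \<open>Q\<close>, which strict convexity in the product forbids.
\<close>

lemma not_three_values:
  assumes "{#x, y, z#} \<subseteq># M" "x \<noteq> y" "y \<noteq> z" "z \<noteq> x"
  shows False
proof -
  obtain N where M: "M = N + {#x, y, z#}"
    using assms(1) by (metis subset_mset.diff_add)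
  define c where "c = (x + y + z) / 3"
  define u where "u = x - c"
  define v where "v = y - c"
  define \<rho> where "\<rho> = sqrt ((u\<^sup>2 + u * v + v\<^sup>2) / 3)"
  have xyz: "x = c + u" "y = c + v" "z = c - u - v"
    by (simp_all add: u_def v_def c_def field_simps)
  have "0 \<le> u\<^sup>2 + u * v + v\<^sup>2"
  proof -
    have "u\<^sup>2 + u * v + v\<^sup>2 = (u + v / 2)\<^sup>2 + 3 / 4 * v\<^sup>2" by (simp add: power2_eq_square field_simps)
    thus ?thesis by simp
  qed
  hence \<rho>: "3 * \<rho>\<^sup>2 = u\<^sup>2 + u * v + v\<^sup>2" "\<rho> \<ge> 0"
    by (simp_all add: \<rho>_def)
  define q where "q = u * v * (- u - v)"
  \<comment> \<open>This is the discriminant of the cubic with roots \<open>u, v, - u - v\<close>.\<close>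
  have "27 * ((2 * \<rho> ^ 3)\<^sup>2 - q\<^sup>2) = 4 * (3 * \<rho>\<^sup>2) ^ 3 - 27 * q\<^sup>2"
    by (simp add: power_mult_distrib flip: power_mult)
  also have "\<dots> = ((u - v) * (v - (- u - v)) * ((- u - v) - u))\<^sup>2"
    unfolding \<rho> q_def by algebra
  also have "\<dots> > 0" using assms xyz by simp
  finally have "q\<^sup>2 < (2 * \<rho> ^ 3)\<^sup>2" by simp
  hence "\<bar>q\<bar> < 2 * \<rho> ^ 3"
    using \<rho>(2) by (intro power2_less_imp_less[of "\<bar>q\<bar>"]) simp_all
  hence q: "q < 2 * \<rho> ^ 3" "- q < 2 * \<rho> ^ 3" by linarith+
  have e2: "x * y + y * z + z * x = 3 * c\<^sup>2 - 3 * \<rho>\<^sup>2"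
    unfolding \<rho> xyz by algebra
  have e3: "x * y * z = c ^ 3 - 3 * \<rho>\<^sup>2 * c + q"
    unfolding \<rho> xyz q_def by algebra
  define P where "P = {#c + 2 * \<rho>, c - \<rho>, c - \<rho>#}"
  define Q where "Q = {#c - 2 * \<rho>, c + \<rho>, c + \<rho>#}"
  have e2P: "(c + 2 * \<rho>) * (c - \<rho>) + (c - \<rho>) * (c - \<rho>) + (c - \<rho>) * (c + 2 * \<rho>) = 3 * c\<^sup>2 - 3 * \<rho>\<^sup>2"
    and e3P: "(c + 2 * \<rho>) * (c - \<rho>) * (c - \<rho>) = c ^ 3 - 3 * \<rho>\<^sup>2 * c + 2 * \<rho> ^ 3" by algebra+
  have e2Q: "(c - 2 * \<rho>) * (c + \<rho>) + (c + \<rho>) * (c + \<rho>) + (c + \<rho>) * (c - 2 * \<rho>) = 3 * c\<^sup>2 - 3 * \<rho>\<^sup>2"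
    and e3Q: "(c - 2 * \<rho>) * (c + \<rho>) * (c + \<rho>) = c ^ 3 - 3 * \<rho>\<^sup>2 * c - 2 * \<rho> ^ 3" by algebra+
  have "((c + 2 * \<rho>) * (c - \<rho>) * (c - \<rho>) - x * y * z) * pchom \<epsilon> k 3 (M + P) \<le> 0"
    unfolding P_def by (rule exchange_le[OF M]) (simp_all only: e2P e2, simp add: xyz)
  hence "(2 * \<rho> ^ 3 - q) * pchom \<epsilon> k 3 (M + P) \<le> 0"
    unfolding e3P e3 by simp
  hence le: "pchom \<epsilon> k 3 (M + P) \<le> 0" using q by (simp add: mult_le_0_iff)
  have "((c - 2 * \<rho>) * (c + \<rho>) * (c + \<rho>) - x * y * z) * pchom \<epsilon> k 3 (M + Q) \<le> 0"
    unfolding Q_def by (rule exchange_le[OF M]) (simp_all only: e2Q e2, simp add: xyz)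
  hence "(- q - 2 * \<rho> ^ 3) * pchom \<epsilon> k 3 (M + Q) \<le> 0"
    unfolding e3Q e3 by simp
  hence ge: "pchom \<epsilon> k 3 (M + Q) \<ge> 0" using q by (simp add: mult_le_0_iff)
  obtain x0 where "x0 \<in># M" "x0 \<noteq> 0" using centred_unit_mset_nonzero[OF centred] by blast
  hence pos: "pchom \<epsilon> k (3 + 3) (M + Q + P) > 0"
    using eps by (intro pchom_pos[of _ _ x0]) auto
  have "pchom \<epsilon> k 3 (M + P) - pchom \<epsilon> k 3 (M + Q)
      = ((c ^ 3 - 3 * \<rho>\<^sup>2 * c + 2 * \<rho> ^ 3) - (c ^ 3 - 3 * \<rho>\<^sup>2 * c - 2 * \<rho> ^ 3)) * pchom \<epsilon> k (3 + 3) (M + Q + P)"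
    unfolding P_def Q_def e3P[symmetric] e3Q[symmetric] 
    by (rule pchom_exchange) (use e2P e2Q in simp_all)
  also have "\<dots> = 4 * \<rho> ^ 3 * pchom \<epsilon> k (3 + 3) (M + Q + P)" by simp
  also have "\<dots> > 0" using q pos by (intro mult_pos_pos) linarith+
  finally show False using le ge by simp
qed

text \<open>
  For \<open>x = y + 7d\<close> the triple \<open>x, y, y\<close> is replaced by \<open>y + 6d, y + 3d, y - 2d\<close> and the triple
  \<open>x, x, y\<close> by \<open>y + 9d, y + 4d, y + d\<close>.  Sums and sums of squares agree because
  \<open>36 + 9 + 4 = 49\<close> and \<open>81 + 16 + 1 = 2 * 49\<close>; the product decreases in the first exchange and
  increases in the second.  Maximality therefore makes \<open>h_{2k-3}\<close> (perturbed) nonnegative at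
  the first new triple adjoined to \<open>M\<close> and nonpositive at the second.  But the second triple is
  entrywise larger, and \<open>h_{2k-3}\<close> increases in each entry, its derivatives having even degree.
\<close>

lemma not_two_pairs:
  assumes "{#x, x, y, y#} \<subseteq># M"
  shows "\<not> y < x"
proof
  assume "y < x"
  obtain N where M: "M = N + {#x, x, y, y#}"
    using assms(1) by (metis subset_mset.diff_add)
  define d where "d = (x - y) / 7"
  have d: "d > 0" using \<open>y < x\<close> by (simp add: d_def)
  have "7 * d = x - y" by (simp add: d_def)
  hence x: "x = y + 7 * d" by simp
  obtain x0 where x0: "x0 \<in># M" "x0 \<noteq> 0" using centred_unit_mset_nonzero[OF centred] by blast
  have M1: "M = add_mset x N + {#x, y, y#}" and M2: "M = add_mset y N + {#x, x, y#}"
    by (simp_all add: M add_mset_commute)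
  have "((y + 6 * d) * (y + 3 * d) * (y - 2 * d) - x * y * y)
      * pchom \<epsilon> k 3 (M + {#y + 6 * d, y + 3 * d, y - 2 * d#}) \<le> 0"
    by (rule exchange_le[OF M1]) (simp_all add: x algebra_simps)
  moreover have "(y + 6 * d) * (y + 3 * d) * (y - 2 * d) - x * y * y = - (36 * d ^ 3)"
    unfolding x by algebra
  ultimately have "pchom \<epsilon> k 3 (M + {#y + 6 * d, y + 3 * d, y - 2 * d#}) \<ge> 0"
    using d by (simp add: zero_le_mult_iff)
  also have "pchom \<epsilon> k 3 (M + {#y + 6 * d, y + 3 * d, y - 2 * d#})
      < pchom \<epsilon> k 3 (M + {#y + 9 * d, y + 3 * d, y - 2 * d#})"
    using pchom_3_strict_mono[OF eps, of x0 "M + {#y + 3 * d, y - 2 * d#}" "y + 6 * d" "y + 9 * d"] x0 d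
    by simp
  also have "\<dots> < pchom \<epsilon> k 3 (M + {#y + 9 * d, y + 4 * d, y - 2 * d#})"
    using pchom_3_strict_mono[OF eps, of x0 "M + {#y + 9 * d, y - 2 * d#}" "y + 3 * d" "y + 4 * d"] x0 d
    by (simp add: add_mset_commute)
  also have "\<dots> < pchom \<epsilon> k 3 (M + {#y + 9 * d, y + 4 * d, y + d#})"
    using pchom_3_strict_mono[OF eps, of x0 "M + {#y + 9 * d, y + 4 * d#}" "y - 2 * d" "y + d"] x0 d
    by (simp add: add_mset_commute)
  finally have "pchom \<epsilon> k 3 (M + {#y + 9 * d, y + 4 * d, y + d#}) > 0" .
  moreover have "((y + 9 * d) * (y + 4 * d) * (y + d) - x * x * y)
      * pchom \<epsilon> k 3 (M + {#y + 9 * d, y + 4 * d, y + d#}) \<le> 0"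
    by (rule exchange_le[OF M2]) (simp_all add: x algebra_simps)
  moreover have "(y + 9 * d) * (y + 4 * d) * (y + d) - x * x * y = 36 * d ^ 3"
    unfolding x by algebra
  ultimately show False using d by (simp add: mult_le_0_iff)
qed

lemma one_against_rest:
  "\<exists>x y. M = add_mset x (replicate_mset (size M - 1) y)"
proof -
  obtain u v where uv: "u \<in># M" "v \<in># M" "u < 0" "0 < v"
    using centred_unit_mset_nonzero[OF centred] sum_mset_zero_signs[of M] centred
    unfolding centred_unit_mset_def by blast
  then obtain K where K: "M = add_mset u (add_mset v K)"
    by (metis add_mset_remove_trivial_If insert_DiffM less_asym multi_member_split insert_noteq_member)
  have "w = u \<or> w = v" if "w \<in># K" for w
    using not_three_values[of u v w] K uv that by (auto simp: insert_subset_eq_iff)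
  hence K2: "set_mset K \<subseteq> {u, v}" by blast
  have "u \<notin># K \<or> v \<notin># K"
  proof (rule ccontr)
    assume "\<not> ?thesis"
    then obtain L where "K = add_mset u (add_mset v L)"
      using uv by (metis insert_noteq_member less_asym multi_member_split)
    with K not_two_pairs[of v u] uv show False by (simp add: add_mset_commute)
  qed
  hence "set_mset K \<subseteq> {v} \<or> set_mset K \<subseteq> {u}" using K2 by blast
  hence "K = replicate_mset (size K) v \<or> K = replicate_mset (size K) u"
    by (meson set_mset_subset_singletonD)
  moreover have "size M - 1 = Suc (size K)" by (simp add: K)
  ultimately show ?thesis using K by (metis add_mset_commute replicate_mset_Suc)
qed

end

definition spike_mset :: "nat \<Rightarrow> real multiset" where
  "spike_mset n = add_mset (sqrt ((real n - 1) / real n))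
     (replicate_mset (n - 1) (- 1 / sqrt (real n * (real n - 1))))"

lemma sum_replicate_mset: "(\<Sum>x\<in>#replicate_mset n y. f x) = real n * f y" for f :: "real \<Rightarrow> real"
  by (induction n) (simp_all add: algebra_simps)

lemma spike_height:
  assumes "n \<ge> 2"
  shows "sqrt ((real n - 1) / real n) = (real n - 1) * (1 / sqrt (real n * (real n - 1)))"
proof -
  have "(real n - 1) / sqrt (real n * (real n - 1))
      = sqrt (real n - 1) * sqrt (real n - 1) / (sqrt (real n) * sqrt (real n - 1))"
    using assms by (simp add: real_sqrt_mult)
  also have "\<dots> = sqrt ((real n - 1) / real n)"
    using assms by (simp add: real_sqrt_divide del: real_sqrt_mult_self)
  finally show ?thesis by simp
qed

lemma centred_spike:
  assumes "n \<ge> 2"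
  shows "centred_unit_mset (spike_mset n)"
proof -
  define s where "s = 1 / sqrt (real n * (real n - 1))"
  have M: "spike_mset n = add_mset ((real n - 1) * s) (replicate_mset (n - 1) (- s))"
    by (simp add: spike_mset_def s_def spike_height[OF assms])
  have s: "s\<^sup>2 * (real n * (real n - 1)) = 1"
    using assms by (simp add: s_def power_divide)
  have "(\<Sum>x\<in>#spike_mset n. x\<^sup>2) = s\<^sup>2 * (real n * (real n - 1))"
    using assms by (simp add: M sum_replicate_mset of_nat_diff power2_eq_square algebra_simps)
  moreover have "\<Sum>\<^sub># (spike_mset n) = 0"
    using assms sum_replicate_mset[of "\<lambda>x. x" "n - 1" "- s"] by (simp add: M of_nat_diff)
  ultimately show ?thesis using s by (simp add: centred_unit_mset_def)
qed

lemma centred_one_against_rest: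
  assumes n: "n \<ge> 2" and M: "centred_unit_mset (add_mset x (replicate_mset (n - 1) y))"
  shows "add_mset x (replicate_mset (n - 1) y) \<in> {spike_mset n, image_mset uminus (spike_mset n)}"
proof -
  have x: "x = - ((real n - 1) * y)" and "x\<^sup>2 + (real n - 1) * y\<^sup>2 = 1"
    using M n sum_replicate_mset[of "\<lambda>x. x"]
    by (simp_all add: centred_unit_mset_def sum_replicate_mset of_nat_diff)
  hence "((real n - 1) * y)\<^sup>2 + (real n - 1) * y\<^sup>2 = 1" by simp
  hence "real n * (real n - 1) * y\<^sup>2 = 1" by (simp add: power2_eq_square algebra_simps)
  hence "y\<^sup>2 = (1 / sqrt (real n * (real n - 1)))\<^sup>2"
    using n by (simp add: power_divide field_simps)
  hence y: "y = - 1 / sqrt (real n * (real n - 1)) \<or> y = 1 / sqrt (real n * (real n - 1))"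
    by (auto simp: power2_eq_iff)
  with x show ?thesis unfolding spike_mset_def spike_height[OF n] by auto
qed

lemma pchom_le_spike:
  assumes n: "n \<ge> 2" and eps: "\<epsilon> > 0" and M: "centred_unit_mset M" "size M = n"
  shows "pchom \<epsilon> k 0 M \<le> pchom \<epsilon> k 0 (spike_mset n)"
proof -
  obtain L where L: "centred_unit_mset L" "size L = n"
    "\<And>N. centred_unit_mset N \<Longrightarrow> size N = n \<Longrightarrow> pchom \<epsilon> k 0 N \<le> pchom \<epsilon> k 0 L"
    using exists_chom_maximiser[OF M, of 1 "2 * k" \<epsilon> 6] by (auto simp: pchom_def)
  interpret pchom_maximiser \<epsilon> k L
    by unfold_locales (use L eps in auto)
  obtain x y where xy: "L = add_mset x (replicate_mset (n - 1) y)"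
    using one_against_rest L(2) by blast
  with centred_one_against_rest[OF n, of x y] L(1)
  have "L = spike_mset n \<or> L = image_mset uminus (spike_mset n)" by auto
  hence "pchom \<epsilon> k 0 L = pchom \<epsilon> k 0 (spike_mset n)"
    by (auto simp: pchom_def chom_uminus_even)
  with L(3)[OF M] show ?thesis by simp
qed

text \<open>
  The bound for \<open>h_{2k} + \<epsilon> h_6\<close> as \<open>\<epsilon>\<close> tends to 0 from the right.
\<close>

lemma chom_le_spike:
  assumes "n \<ge> 2" "centred_unit_mset M" "size M = n"
  shows "chom (int (2 * k)) M \<le> chom (int (2 * k)) (spike_mset n)"
proof -
  have "((\<lambda>\<epsilon>. pchom \<epsilon> k 0 L) \<longlongrightarrow> pchom 0 k 0 L) (at_right 0)" for L
    unfolding pchom_def by (intro tendsto_intros)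
  moreover have "eventually (\<lambda>\<epsilon>. pchom \<epsilon> k 0 M \<le> pchom \<epsilon> k 0 (spike_mset n)) (at_right 0)"
    using eventually_at_right_less[of 0] by eventually_elim (rule pchom_le_spike[OF assms(1) _ assms(2,3)])
  ultimately have "pchom 0 k 0 M \<le> pchom 0 k 0 (spike_mset n)"
    by (intro tendsto_le[OF trivial_limit_at_right_real])
  thus ?thesis by (simp add: pchom_def)
qed

lemma coords_max_vector:
  assumes "n \<ge> 2"
  shows "coords n (max_vector n) = spike_mset n"
proof -
  obtain m where n: "n = Suc m" using assms by (cases n) auto
  have "coords m (max_vector n) = image_mset (\<lambda>_. - 1 / sqrt (real n * (real n - 1))) (mset_set {1..m})"
    unfolding coords_def by (intro image_mset_cong) (auto simp: max_vector_def n)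
  also have "\<dots> = replicate_mset m (- 1 / sqrt (real n * (real n - 1)))"
    by (simp add: image_mset_const_eq)
  finally show ?thesis
    by (simp add: n coords_Suc spike_mset_def max_vector_def)
qed

section \<open>The two extremal problems\<close>

theorem theorem5p1:
  fixes k :: nat
  assumes "k \<ge> 1"
  shows
    "(\<forall>n::nat. even n \<and> n > 0 \<longrightarrow>
        (\<forall>a. centred_unit_vector n a \<longrightarrow>
           complete_hom (2 * k) n a
             \<ge> fact (n div 2 + k - 1) / (fact k * fact (n div 2 - 1) * real n ^ k)) \<and>
        centred_unit_vector n (min_vector n) \<and>
        complete_hom (2 * k) n (min_vector n)
          = fact (n div 2 + k - 1) / (fact k * fact (n div 2 - 1) * real n ^ k)) \<and>
     (\<forall>n::nat. n \<ge> 2 \<longrightarrow>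
        centred_unit_vector n (max_vector n) \<and>
        (\<forall>a. centred_unit_vector n a \<longrightarrow>
           complete_hom (2 * k) n a \<le> complete_hom (2 * k) n (max_vector n)))"
proof (intro conjI allI impI; (elim conjE)?)
  fix n :: nat and a assume "even n" "n > 0" "centred_unit_vector n a"
  then show "complete_hom (2 * k) n a
      \<ge> fact (n div 2 + k - 1) / (fact k * fact (n div 2 - 1) * real n ^ k)"
    using chom_lower_bound[of "coords n a" n k]
    by (simp only: fact_quotient_eq_pochhammer complete_hom_eq_chom centred_unit_coords size_coords)
next
  fix n :: nat assume n: "even n" "n > 0"
  then show cu: "centred_unit_vector n (min_vector n)" by (rule centred_min_vector)
  show "complete_hom (2 * k) n (min_vector n)
      = fact (n div 2 + k - 1) / (fact k * fact (n div 2 - 1) * real n ^ k)"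
    unfolding fact_quotient_eq_pochhammer[OF n] complete_hom_eq_chom
  proof (rule chom_constant_squares)
    show "\<Sum>\<^sub># (coords n (min_vector n)) = 0"
      using cu by (simp add: centred_unit_mset_def flip: centred_unit_coords)
    show "x\<^sup>2 = 1 / real n" if "x \<in># coords n (min_vector n)" for x
      using that by (auto simp: in_coords_iff min_vector_def power_divide)
  qed (use n in simp_all)
next
  fix n :: nat assume n: "n \<ge> 2"
  then show "centred_unit_vector n (max_vector n)"
    using centred_spike[OF n] by (simp add: coords_max_vector flip: centred_unit_coords)
  fix a assume "centred_unit_vector n a"
  with n show "complete_hom (2 * k) n a \<le> complete_hom (2 * k) n (max_vector n)"
    unfolding complete_hom_eq_chom coords_max_vector[OF n]
    by (intro chom_le_spike) (simp_all add: centred_unit_coords)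
qed

end
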